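(* Let $P$ be a probability distribution on $\mathbb N$ with finite mean and $P(1)<1$, and let $T$ be the Erlang Weighted Tree with potential degree distribution $P$. For a vertex $\boldsymbol i$ of $T$ let $D_{\boldsymbol i}$ be the number of its descendants (children) in $T$. Then the conditional distribution of $D_{\boldsymbol i}$ given the type of $\boldsymbol i$ is $$\mathbb P\left(D_{\boldsymbol i}=d\mid n_{\boldsymbol i}=m,\ v_{\boldsymbol i}=x\right)=\mathrm{Bi}\left(d;m,\int_0^x\frac1x\sum_{k=1}^\infty P(k)\bar F_k(y)\,dy\right).$$ Consequently, the degree distribution of the root $o$ and its mean are $$\mathbb P(D_o=d)=\sum_{m=1}^\infty P(m)\int_0^\infty\frac{e^{-x}x^m}{m!}\,\mathrm{Bi}\left(d;m,\int_0^x\frac1x\sum_{k=1}^\infty P(k)\bar F_k(y)\,dy\right)dx,$$ $$\mathbb E[D_o]=\sum_{m=1}^\infty\sum_{k=1}^\infty P(m)P(k)\int_0^\infty\bar F_k(y)\bar F_m(y)\,dy=\sum_{m=1}^\infty\sum_{k=1}^\infty P(m)P(k)\sum_{n=0}^{k-1}\sum_{l=0}^{m-1}\binom{n+l}{n}2^{-n-l-1}.$$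
   Context: $\mathbb N=\{1,2,\dots\}$, $\mathbb Z_+=\{0,1,\dots\}$. $\mathrm{Erlang}(k)$ has density $e^{-x}x^{k-1}/(k-1)!$ on $\mathbb R_+=[0,\infty)$; $\bar F_k$ is its complementary cumulative distribution function. $\mathrm{Bi}(d;m,\eta)=\binom md\eta^d(1-\eta)^{m-d}$. **Erlang Weighted Tree (EWT).** Let $\mathbb N^f=\bigcup_{i\ge0}\mathbb N^i$, $\mathbb N^0=\{o\}$, and $\widehat P(k)=P(k+1)$, $k\in\mathbb Z_+$. Independently over $\boldsymbol i\in\mathbb N^f$: $n_o\sim P$, $n_{\boldsymbol i}\sim\widehat P$ for $\boldsymbol i\ne o$; given $n_{\boldsymbol i}$, $v_{\boldsymbol i}\sim\mathrm{Erlang}(n_{\boldsymbol i}+1)$; given $(n_{\boldsymbol i},v_{\boldsymbol i})$, the costs $\zeta_{(\boldsymbol i,1)},\dots,\zeta_{(\boldsymbol i,n_{\boldsymbol i})}$ are i.i.d. uniform on $[0,v_{\boldsymbol i}]$. The backbone tree is the component of $o$ in the graph with (potential) edges $\{\boldsymbol i,(\boldsymbol i,j)\}$, $1\le j\le n_{\boldsymbol i}$. The EWT is the component of the root $o$ after keeping the edge $\{\boldsymbol i,(\boldsymbol i,j)\}$ iff $\zeta_{(\boldsymbol i,j)}<v_{(\boldsymbol i,j)}$. The type of $\boldsymbol i$ is $(n_{\boldsymbol i},v_{\boldsymbol i})$; the children of $\boldsymbol i$ in the EWT are the vertices $(\boldsymbol i,j)$, $1\le j\le n_{\boldsymbol i}$,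 with $\zeta_{(\boldsymbol i,j)}<v_{(\boldsymbol i,j)}$. *)

theory Defs
  imports "HOL-Probability.Probability"
begin

text \<open>
  The index set \<open>\<nat>\<^sup>f\<close> consists of the finite words over \<open>{1, 2, \<dots>}\<close>: the root is the empty word and
  the \<open>j\<close>-th potential child of \<open>i\<close> is \<open>i @ [j]\<close>.  The cost \<open>\<zeta> (i @ [j])\<close> belongs to the
  potential edge between \<open>i\<close> and \<open>i @ [j]\<close>; the value \<open>\<zeta> []\<close> is never used.
\<close>

definition words :: "nat list set" where
  "words = lists {1..}"

definition component :: "('a \<times> 'a) set \<Rightarrow> 'a \<Rightarrow> 'a set" where
  "component E r = {i. (r, i) \<in> (E \<union> E\<inverse>)\<^sup>*}"

definition potential_edges :: "(nat list \<Rightarrow> nat) \<Rightarrow> (nat list \<times> nat list) set" where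
  "potential_edges n = {(i, i @ [j]) | i j. i \<in> words \<and> 1 \<le> j \<and> j \<le> n i}"

definition backbone :: "(nat list \<Rightarrow> nat) \<Rightarrow> nat list set" where
  "backbone n = component (potential_edges n) []"

definition kept_edges ::
  "(nat list \<Rightarrow> nat) \<Rightarrow> (nat list \<Rightarrow> real) \<Rightarrow> (nat list \<Rightarrow> real) \<Rightarrow> (nat list \<times> nat list) set" where
  "kept_edges n v \<zeta> = {(i, k) \<in> potential_edges n. i \<in> backbone n \<and> \<zeta> k < v k}"

definition ewt ::
  "(nat list \<Rightarrow> nat) \<Rightarrow> (nat list \<Rightarrow> real) \<Rightarrow> (nat list \<Rightarrow> real) \<Rightarrow> nat list set" where
  "ewt n v \<zeta> = component (kept_edges n v \<zeta>) []"

definition children ::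
  "(nat list \<Rightarrow> nat) \<Rightarrow> (nat list \<Rightarrow> real) \<Rightarrow> (nat list \<Rightarrow> real) \<Rightarrow> nat list \<Rightarrow> nat list set" where
  "children n v \<zeta> i = {i @ [j] | j. 1 \<le> j \<and> j \<le> n i \<and> \<zeta> (i @ [j]) < v (i @ [j])}"

definition num_children ::
  "(nat list \<Rightarrow> nat) \<Rightarrow> (nat list \<Rightarrow> real) \<Rightarrow> (nat list \<Rightarrow> real) \<Rightarrow> nat list \<Rightarrow> nat" where
  "num_children n v \<zeta> i = card (children n v \<zeta> i)"

text \<open>
  The randomness attached to \<open>i\<close>: its type together with the costs of its \<open>n i\<close> potential
  edges.  Costs at positions other than \<open>1, \<dots>, n i\<close> do not exist in the model; they are masked
  by 0, so that nothing is assumed about them.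
\<close>

definition mark ::
  "(nat list \<Rightarrow> nat) \<Rightarrow> (nat list \<Rightarrow> real) \<Rightarrow> (nat list \<Rightarrow> real) \<Rightarrow> nat list \<Rightarrow> nat \<times> real \<times> (nat \<Rightarrow> real)" where
  "mark n v \<zeta> i = (n i, v i, \<lambda>j. if 1 \<le> j \<and> j \<le> n i then \<zeta> (i @ [j]) else 0)"

definition mark_space :: "(nat \<times> real \<times> (nat \<Rightarrow> real)) measure" where
  "mark_space = count_space UNIV \<Otimes>\<^sub>M borel \<Otimes>\<^sub>M (\<Pi>\<^sub>M j\<in>UNIV. borel)"

text \<open>The law of \<open>n i\<close>: \<open>P\<close> at the root and the shift \<open>k \<mapsto> P (k + 1)\<close> elsewhere.\<close>

definition potential_degree_prob :: "nat pmf \<Rightarrow> nat list \<Rightarrow> nat \<Rightarrow> real" where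
  "potential_degree_prob P i m = (if i = [] then pmf P m else pmf P (m + 1))"

text \<open>
  Note that \<open>erlang_density k 1\<close> is the density of \<open>Erlang(k + 1)\<close>.  The axiom \<open>mark_law\<close> is the
  joint law of \<open>(n, v, costs)\<close> written as the composition of its three conditional laws:
  \<open>n\<close> has the given law, \<open>v\<close> is \<open>Erlang(m + 1)\<close> given \<open>n = m\<close>, and given \<open>n = m\<close>, \<open>v = x\<close> the
  \<open>m\<close> costs are independent and uniform on \<open>[0, x]\<close>.
\<close>

locale erlang_weighted_tree = prob_space M
  for M :: "'w measure" +
  fixes P :: "nat pmf"
    and n :: "'w \<Rightarrow> nat list \<Rightarrow> nat"
    and v :: "'w \<Rightarrow> nat list \<Rightarrow> real"
    and \<zeta> :: "'w \<Rightarrow> nat list \<Rightarrow> real"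
  assumes marks_indep:
    "indep_vars (\<lambda>_. mark_space) (\<lambda>i \<omega>. mark (n \<omega>) (v \<omega>) (\<zeta> \<omega>) i) words"
  and mark_law:
    "\<And>i m B C. i \<in> words \<Longrightarrow> B \<in> sets borel \<Longrightarrow> (\<And>j. C j \<in> sets borel) \<Longrightarrow>
       emeasure M {\<omega> \<in> space M. n \<omega> i = m \<and> v \<omega> i \<in> B \<and> (\<forall>j\<in>{1..m}. \<zeta> \<omega> (i @ [j]) \<in> C j)} =
       ennreal (potential_degree_prob P i m) *
       (\<integral>\<^sup>+x\<in>B. ennreal (erlang_density m 1 x) *
          (\<Prod>j=1..m. emeasure (uniform_measure lborel {0..x}) (C j)) \<partial>lborel)"

definition type_algebra ::
  "'w measure \<Rightarrow> ('w \<Rightarrow> nat list \<Rightarrow> nat) \<Rightarrow> ('w \<Rightarrow> nat list \<Rightarrow> real) \<Rightarrow> nat list \<Rightarrow> 'w measure" where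
  "type_algebra M n v i =
     vimage_algebra (space M) (\<lambda>\<omega>. (n \<omega> i, v \<omega> i)) (count_space UNIV \<Otimes>\<^sub>M borel)"

text \<open>
  \<open>has_cond_prob_given_type M n v i A g\<close> says that
  \<open>(m, x) \<mapsto> g m x\<close> is a version of the conditional probability of \<open>A\<close> given
  \<open>n i = m\<close>, \<open>v i = x\<close>; the conditioning event has probability 0, so such a version is
  determined only up to null sets of types.
\<close>

definition has_cond_prob_given_type ::
  "'w measure \<Rightarrow> ('w \<Rightarrow> nat list \<Rightarrow> nat) \<Rightarrow> ('w \<Rightarrow> nat list \<Rightarrow> real) \<Rightarrow> nat list \<Rightarrow>
     'w set \<Rightarrow> (nat \<Rightarrow> real \<Rightarrow> real) \<Rightarrow> bool" where
  "has_cond_prob_given_type M n v i A g \<longleftrightarrow>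
     (AE \<omega> in M. real_cond_exp M (type_algebra M n v i) (indicator A) \<omega> = g (n \<omega> i) (v \<omega> i))"

definition Bi :: "nat \<Rightarrow> nat \<Rightarrow> real \<Rightarrow> real" where
  "Bi d m \<eta> = real (m choose d) * \<eta> ^ d * (1 - \<eta>) ^ (m - d)"

text \<open>The complementary distribution function of \<open>Erlang(k)\<close>, meaningful for \<open>k \<ge> 1\<close>.\<close>

definition erlang_ccdf :: "nat \<Rightarrow> real \<Rightarrow> real" where
  "erlang_ccdf k y = measure (density lborel (erlang_density (k - 1) 1)) {y<..}"

definition keep_prob :: "nat pmf \<Rightarrow> real \<Rightarrow> real" where
  "keep_prob P x = (LBINT y:{0..x}. 1 / x * (\<Sum>\<^sub>\<infinity>k\<in>{1..}. pmf P k * erlang_ccdf k y))"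

end

theory Submission
  imports Defs
begin

text \<open>
  Fix a vertex \<open>i\<close> with \<open>n i = m\<close> and \<open>v i = x\<close>.  Its potential edges have i.i.d. uniform costs on
  \<open>[0, x]\<close>, its potential children have i.i.d. parameters that are independent of these costs, and
  a potential child is kept with probability \<open>\<integral>\<^sub>0\<^sup>x (1 / x) \<Sum>\<^sub>k P(k) F\<^sub>k(y) dy\<close>, where \<open>F\<^sub>k\<close> is the
  tail of \<open>Erlang(k)\<close>; summing over the possible sets of kept children gives the binomial law.
  Membership of \<open>i\<close> in the tree depends only on the marks of the ancestors of \<open>i\<close> and on \<open>v i\<close>,
  and the former are independent of the marks of \<open>i\<close> and its children, so conditioning on it
  changes nothing.  For the mean, \<open>m e\<^sup>-\<^sup>x x\<^sup>m / m! / x\<close> is the \<open>Erlang(m)\<close> density, and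
  exchanging the integrals over \<open>x\<close> and \<open>y \<le> x\<close> produces the factor \<open>F\<^sub>m(y)\<close>.
\<close>

section \<open>Vertices of the tree\<close>

text \<open>All costs at \<open>i\<close> are uniform on the same random interval
  \<open>[0, v i]\<close>, so the kept edges become independent once the type of \<open>i\<close> is
  fixed. The obstacle is that \<open>mark_law\<close> speaks of rectangles in the costs, whereas an
  edge is kept by comparing a cost with the parameter of another vertex; this is a condition of
  rectangle type only after the parameters of the children are frozen. The cost of the edge leading
  to \<open>i\<close> belongs to the mark of its parent, but it is compared with \<open>v i\<close>.
  Hence membership in the tree involves the type of \<open>i\<close>, and the conditioning event is
  carried along as an arbitrary measurable set \<open>S\<close> of pairs (marks of the ancestors,
  \<open>v i\<close>). The unconditional law is the case without ancestors and with a full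
  \<open>S\<close>. The main computations take place in \<open>ennreal\<close>, where Tonelli's
  theorem covers the exchanges of sums and integrals; real integrals and infinite sums enter at the
  end. The value \<open>x = 0\<close>, at which the uniform law on \<open>[0, x]\<close>
  degenerates, is avoided as a null set.\<close>

lemma component_extensions:
  assumes E: "E \<subseteq> {(i, i @ [j]) | i j. True}"
  shows "component E [] = {i. \<forall>k<length i. (take k i, take (Suc k) i) \<in> E}"
proof (intro set_eqI iffI)
  fix i assume "i \<in> component E []"
  then have "([], i) \<in> (E \<union> E\<inverse>)\<^sup>*"
    by (simp add: component_def)
  then show "i \<in> {i. \<forall>k<length i. (take k i, take (Suc k) i) \<in> E}"
  \<comment> \<open>Invariant along an undirected path: all edges between consecutive prefixes of
    the current word are in \<open>E\<close>. A forward step adds one such edge, a backward step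
    drops the last one.\<close>
  proof induction
    case (step b c)
    from step.hyps(2) show ?case
    proof
      assume bc: "(b, c) \<in> E"
      then obtain j where "c = b @ [j]" using E by auto
      then show ?thesis using step.IH bc by (auto simp: less_Suc_eq)
    next
      assume "(b, c) \<in> E\<inverse>"
      then obtain j where b: "b = c @ [j]" using E by auto
      have "(take k c, take (Suc k) c) \<in> E" if "k < length c" for k
        using step.IH[simplified, rule_format, of k] that by (simp add: b)
      then show ?thesis by simp
    qed
  qed simp
next
  fix i assume "i \<in> {i. \<forall>k<length i. (take k i, take (Suc k) i) \<in> E}"
  then show "i \<in> component E []"
  proof (induction i rule: rev_induct)
    case (snoc j i)
    have "(take k i, take (Suc k) i) \<in> E" if "k < length i" for k
      using snoc.prems[simplified, rule_format, of k] that by simp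
    then have "i \<in> component E []" using snoc.IH by simp
    moreover have "(i, i @ [j]) \<in> E"
      using snoc.prems[simplified, rule_format, of "length i"] by simp
    ultimately show ?case
      by (auto simp: component_def intro: rtrancl_into_rtrancl)
  qed (simp add: component_def)
qed

lemma Nil_in_words [simp]: "[] \<in> words"
  by (simp add: words_def)

lemma snoc_in_words [simp]: "i @ [j] \<in> words \<longleftrightarrow> i \<in> words \<and> 1 \<le> j"
  by (auto simp: words_def)

lemma take_in_words: "i \<in> words \<Longrightarrow> take k i \<in> words"
  by (auto simp: words_def dest: in_set_takeD)

lemma take_edge_potential:
  assumes "i \<in> words" "k < length i"
  shows "(take k i, take (Suc k) i) \<in> potential_edges n \<longleftrightarrow> i ! k \<le> n (take k i)"
proof -
  have "1 \<le> i ! k"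
    using assms by (auto simp: words_def)
  then show ?thesis
    using assms take_in_words[OF assms(1)]
    by (auto simp: potential_edges_def take_Suc_conv_app_nth)
qed

lemma mem_backbone_iff:
  assumes "i \<in> words"
  shows "i \<in> backbone n \<longleftrightarrow> (\<forall>k<length i. i ! k \<le> n (take k i))"
proof -
  have "potential_edges n \<subseteq> {(i, i @ [j]) | i j. True}"
    by (auto simp: potential_edges_def)
  then show ?thesis
    using take_edge_potential[OF assms] by (auto simp: backbone_def component_extensions)
qed

text \<open>Only the path of prefixes of \<open>i\<close> matters. The conditions concern marks of
  proper prefixes, except that the last comparison has \<open>v i\<close> on its right-hand side;
  this shape later separates the ancestors from \<open>i\<close>.\<close>

lemma mem_ewt_iff:
  assumes "i \<in> words"
  shows "i \<in> ewt n v \<zeta> \<longleftrightarrow>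
    (\<forall>k<length i. i ! k \<le> n (take k i) \<and> \<zeta> (take (Suc k) i) < v (take (Suc k) i))"
proof -
  have E: "kept_edges n v \<zeta> \<subseteq> {(i, i @ [j]) | i j. True}"
    by (auto simp: kept_edges_def potential_edges_def)
  \<comment> \<open>\<open>kept_edges\<close> also asks that the upper end of the edge lie in the
    backbone; this follows from the degree conditions on the shorter prefixes.\<close>
  have "take k i \<in> backbone n" if "\<forall>k<length i. i ! k \<le> n (take k i)" "k < length i" for k
    using that assms by (auto simp: mem_backbone_iff take_in_words min_def)
  then show ?thesis
    using take_edge_potential[OF assms]
    unfolding ewt_def component_extensions[OF E] by (auto simp: kept_edges_def)
qed

lemma num_children_eq: "num_children n v \<zeta> i = card {j \<in> {1..n i}. \<zeta> (i @ [j]) < v (i @ [j])}"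
proof -
  have "children n v \<zeta> i = (\<lambda>j. i @ [j]) ` {j \<in> {1..n i}. \<zeta> (i @ [j]) < v (i @ [j])}"
    by (auto simp: children_def)
  moreover have "inj_on (\<lambda>j. i @ [j]) A" for A
    by (auto simp: inj_on_def)
  ultimately show ?thesis
    by (simp add: num_children_def card_image)
qed

section \<open>Binomial weights and expectations under \<open>P\<close>\<close>

lemma Bi_eq_Bernstein: "Bi d m \<eta> = Bernstein m d \<eta>"
  by (simp add: Bi_def Bernstein_def)

lemma Bi_nonneg: "0 \<le> \<eta> \<Longrightarrow> \<eta> \<le> 1 \<Longrightarrow> 0 \<le> Bi d m \<eta>"
  by (simp add: Bi_def)

lemma Bi_le_1:
  assumes "0 \<le> \<eta>" "\<eta> \<le> 1"
  shows "Bi d m \<eta> \<le> 1"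
proof (cases "d \<le> m")
  case True
  \<comment> \<open>The full sum of binomial weights is 1, a known identity for Bernstein
    polynomials.\<close>
  then have "Bi d m \<eta> \<le> (\<Sum>d\<le>m. Bi d m \<eta>)"
    using assms by (intro member_le_sum) (auto intro: Bi_nonneg)
  then show ?thesis
    by (simp add: Bi_eq_Bernstein)
qed (simp add: Bi_def binomial_eq_0)

lemma Bi_measurable [measurable]:
  assumes [measurable]: "f \<in> measurable N (count_space UNIV)" "g \<in> borel_measurable N"
  shows "(\<lambda>x. Bi d (f x) (g x)) \<in> borel_measurable N"
  by (rule measurable_compose_countable'[of UNIV, where f = "\<lambda>m x. Bi d m (g x)"])
    (auto simp: Bi_def)

text \<open>The index 0 carries no mass. The identity covers every \<open>f\<close>: without
  absolute summability the infinite sum and the integral both take the default value 0.\<close>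

lemma infsum_pmf_eq_integral:
  fixes P :: "nat pmf" and f :: "nat \<Rightarrow> real"
  assumes "set_pmf P \<subseteq> {1..}"
  shows "(\<Sum>\<^sub>\<infinity>k\<in>{1..}. pmf P k * f k) = (\<integral>k. f k \<partial>measure_pmf P)"
proof -
  have "(\<Sum>\<^sub>\<infinity>k\<in>{1..}. pmf P k * f k) = (\<Sum>\<^sub>\<infinity>k. pmf P k * f k)"
    using assms by (intro infsum_cong_neutral) (auto simp: set_pmf_iff)
  also have "\<dots> = (\<integral>k. f k \<partial>measure_pmf P)"
  proof (cases "(\<lambda>k. norm (pmf P k * f k)) summable_on UNIV")
    case True
    then have "Infinite_Set_Sum.abs_summable_on (\<lambda>k. pmf P k * f k) UNIV"
      using abs_summable_equivalent by blast
    from infsetsum_infsum[OF this] show ?thesis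
      by (simp add: pmf_expectation_eq_infsetsum)
  next
    case False
    then have "\<not> (\<lambda>k. pmf P k * f k) summable_on UNIV"
      by (metis summable_on_iff_abs_summable_on_real)
    moreover have "\<not> Infinite_Set_Sum.abs_summable_on (\<lambda>k. pmf P k * f k) UNIV"
      using False abs_summable_equivalent[of "\<lambda>k. pmf P k * f k" UNIV] by blast
    ultimately show ?thesis
      by (simp add: pmf_expectation_eq_infsetsum infsum_not_exists not_summable_infsetsum_eq)
  qed
  finally show ?thesis .
qed

section \<open>Erlang tails and the probability of keeping an edge\<close>

lemma erlang_density_neg: "x < 0 \<Longrightarrow> erlang_density m 1 x = 0"
  by (simp add: erlang_density_def)

lemma ennreal_erlang_ccdf:
  "ennreal (erlang_ccdf k y) = emeasure (density lborel (erlang_density (k - 1) 1)) {y<..}"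
proof -
  interpret prob_space "density lborel (erlang_density (k - 1) 1)"
    by (rule prob_space_erlang_density) simp
  show ?thesis
    unfolding erlang_ccdf_def by (rule emeasure_eq_measure[symmetric])
qed

lemma ennreal_erlang_ccdf_eq:
  "ennreal (erlang_ccdf k y) = (\<integral>\<^sup>+x. ennreal (erlang_density (k - 1) 1 x) * indicator {y<..} x \<partial>lborel)"
  by (simp add: ennreal_erlang_ccdf emeasure_density)

lemma erlang_ccdf_nonneg [simp]: "0 \<le> erlang_ccdf k y"
  by (simp add: erlang_ccdf_def)

lemma erlang_ccdf_le_1 [simp]: "erlang_ccdf k y \<le> 1"
proof -
  interpret prob_space "density lborel (erlang_density (k - 1) 1)"
    by (rule prob_space_erlang_density) simp
  show ?thesis
    unfolding erlang_ccdf_def by (rule prob_le_1)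
qed

text \<open>The \<open>k\<close>-th point of a Poisson process of rate 1 comes after
  \<open>y\<close> iff at most \<open>k - 1\<close> points lie before; formally the sum is read off
  \<open>erlang_CDF\<close>.\<close>

lemma erlang_ccdf_eq_sum:
  assumes "0 \<le> y" "1 \<le> k"
  shows "erlang_ccdf k y = (\<Sum>a=0..k-1. y ^ a * exp (- y) / fact a)"
proof -
  interpret prob_space "density lborel (erlang_density (k - 1) 1)"
    by (rule prob_space_erlang_density) simp
  have "erlang_ccdf k y = 1 - prob {..y}"
    using prob_compl[of "{..y}"] by (simp add: erlang_ccdf_def Compl_eq_Diff_UNIV[symmetric])
  also have "prob {..y} = erlang_CDF (k - 1) 1 y"
    by (simp add: measure_def emeasure_erlang_density)
  finally show ?thesis
    using assms by (simp add: erlang_CDF_def atLeast0AtMost)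
qed

text \<open>Writing the tail as an integral with the parameter \<open>y\<close> inside the integrand
  leaves measurability to parametrised integrals.\<close>

lemma erlang_ccdf_measurable [measurable]: "erlang_ccdf k \<in> borel_measurable borel"
proof -
  have "(\<lambda>y. ennreal (erlang_ccdf k y)) =
      (\<lambda>y. \<integral>\<^sup>+x. ennreal (erlang_density (k - 1) 1 x) * (if y < x then 1 else 0) \<partial>lborel)"
    unfolding ennreal_erlang_ccdf_eq
    by (intro ext nn_integral_cong) (auto split: split_indicator)
  then have "(\<lambda>y. ennreal (erlang_ccdf k y)) \<in> borel_measurable borel"
    by simp
  then have "(\<lambda>y. enn2real (ennreal (erlang_ccdf k y))) \<in> borel_measurable borel"
    by measurable
  then show ?thesis
    by (simp add: enn2real_ennreal)
qed

text \<open>Up to the factor \<open>fact k / 2 ^ (k + 1)\<close> the integrand is the Erlang density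
  of shape \<open>k + 1\<close> and rate 2.\<close>

lemma nn_integral_exp_2_power:
  "(\<integral>\<^sup>+y\<in>{0..}. ennreal (y ^ k * exp (- 2 * y)) \<partial>lborel) = ennreal (fact k / 2 ^ (k + 1))"
proof -
  have "(\<integral>\<^sup>+y\<in>{0..}. ennreal (y ^ k * exp (- 2 * y)) \<partial>lborel) =
      (\<integral>\<^sup>+y. ennreal (fact k / 2 ^ (k + 1)) * ennreal (erlang_density k 2 y) \<partial>lborel)"
    by (intro nn_integral_cong)
      (auto simp: erlang_density_def ennreal_mult[symmetric] field_simps split: split_indicator)
  also have "\<dots> = ennreal (fact k / 2 ^ (k + 1))"
    using nn_integral_erlang_ith_moment[of 2 k 0] by (subst nn_integral_cmult) auto
  finally show ?thesis .
qed

text \<open>Both tails are finite sums of terms \<open>y ^ a * exp (- y) / fact a\<close>, so a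
  product of two terms has rate 2 and integrates to
  \<open>fact (a + l) / (fact a * fact l) / 2 ^ (a + l + 1)\<close>. This is the origin of the
  binomial coefficient and of the powers of 1/2.\<close>

lemma nn_integral_erlang_ccdf_mult:
  assumes "1 \<le> k" "1 \<le> m"
  shows "(\<integral>\<^sup>+y\<in>{0..}. ennreal (erlang_ccdf k y * erlang_ccdf m y) \<partial>lborel) =
    ennreal (\<Sum>a=0..k-1. \<Sum>l=0..m-1. real ((a + l) choose a) * (1 / 2) ^ (a + l + 1))"
proof -
  have eq: "ennreal (erlang_ccdf k y * erlang_ccdf m y) * indicator {0..} y =
      (\<Sum>a=0..k-1. \<Sum>l=0..m-1. ennreal (1 / (fact a * fact l)) *
        (ennreal (y ^ (a + l) * exp (- 2 * y)) * indicator {0..} y))" for y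
  proof (cases "0 \<le> y")
    case True
    have "erlang_ccdf k y * erlang_ccdf m y = (\<Sum>a=0..k-1. \<Sum>l=0..m-1.
        1 / (fact a * fact l) * (y ^ (a + l) * exp (- 2 * y)))"
      using True assms
      by (simp add: erlang_ccdf_eq_sum sum_product power_add mult_exp_exp algebra_simps)
    then show ?thesis
      using True by (simp add: ennreal_mult[symmetric] sum_nonneg sum_ennreal)
  qed simp
  have "(\<integral>\<^sup>+y\<in>{0..}. ennreal (erlang_ccdf k y * erlang_ccdf m y) \<partial>lborel) =
      (\<Sum>a=0..k-1. \<Sum>l=0..m-1. ennreal (1 / (fact a * fact l)) * ennreal (fact (a + l) / 2 ^ (a + l + 1)))"
    unfolding eq nn_integral_exp_2_power[symmetric]
    by (simp add: nn_integral_sum nn_integral_cmult)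
  also have "\<dots> = ennreal (\<Sum>a=0..k-1. \<Sum>l=0..m-1. 1 / (fact a * fact l) * (fact (a + l) / 2 ^ (a + l + 1)))"
    by (simp add: ennreal_mult[symmetric] sum_nonneg sum_ennreal)
  also have "(\<Sum>a=0..k-1. \<Sum>l=0..m-1. 1 / (fact a * fact l) * (fact (a + l) / 2 ^ (a + l + 1))) =
      (\<Sum>a=0..k-1. \<Sum>l=0..m-1. real ((a + l) choose a) * (1 / 2) ^ (a + l + 1))"
    by (intro sum.cong refl) (simp add: binomial_fact power_divide)
  finally show ?thesis .
qed

text \<open>The tail is the sum of the Erlang densities of shapes 1 to \<open>m\<close>, each of
  total mass 1. The value is the mean of Erlang(m); it serves to bound the integral of a product of
  two tails.\<close>

lemma nn_integral_erlang_ccdf: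
  assumes "1 \<le> m"
  shows "(\<integral>\<^sup>+y\<in>{0..}. ennreal (erlang_ccdf m y) \<partial>lborel) = of_nat m"
proof -
  have eq: "ennreal (erlang_ccdf m y) * indicator {0..} y =
      (\<Sum>a=0..m-1. ennreal (erlang_density a 1 y))" for y
    using assms by (cases "0 \<le> y") (auto simp: erlang_ccdf_eq_sum erlang_density_def sum_ennreal)
  have "(\<integral>\<^sup>+y. ennreal (erlang_density a 1 y) \<partial>lborel) = 1" for a
    using nn_integral_erlang_ith_moment[of 1 a 0] by simp
  then show ?thesis
    unfolding eq using assms by (simp add: nn_integral_sum del: sum_ennreal)
qed

text \<open>
  The tail of \<open>v i\<close> for \<open>i \<noteq> o\<close>: under the shifted law \<open>n i = k - 1\<close> has probability \<open>P k\<close>, and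
  then \<open>v i\<close> is \<open>Erlang(k)\<close>.
\<close>

definition survival :: "nat pmf \<Rightarrow> real \<Rightarrow> real" where
  "survival P y = (\<integral>k. erlang_ccdf k y \<partial>measure_pmf P)"

lemma ennreal_survival: "ennreal (survival P y) = (\<integral>\<^sup>+k. ennreal (erlang_ccdf k y) \<partial>measure_pmf P)"
  unfolding survival_def
  by (rule nn_integral_eq_integral[symmetric])
    (auto intro!: measure_pmf.integrable_const_bound[where B = 1])

lemma survival_nonneg [simp]: "0 \<le> survival P y"
  by (simp add: survival_def)

lemma survival_le_1 [simp]: "survival P y \<le> 1"
proof -
  have "survival P y \<le> (\<integral>k. 1 \<partial>measure_pmf P)"
    unfolding survival_def
    by (intro integral_mono measure_pmf.integrable_const_bound[where B = 1]) auto
  then show ?thesis by simp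
qed

lemma survival_measurable [measurable]: "survival P \<in> borel_measurable borel"
proof -
  have "case_prod (\<lambda>y k. erlang_ccdf k y) \<in> borel_measurable (borel \<Otimes>\<^sub>M count_space UNIV)"
    unfolding case_prod_beta
    by (rule measurable_compose_countable'[where I = UNIV and g = snd and f = "\<lambda>k x. erlang_ccdf k (fst x)"])
      auto
  then have "case_prod (\<lambda>y k. erlang_ccdf k y) \<in> borel_measurable (borel \<Otimes>\<^sub>M measure_pmf P)"
    by (simp cong: measurable_cong_sets sets_pair_measure_cong)
  then show ?thesis
    unfolding survival_def[abs_def]
    by (intro measure_pmf.borel_measurable_lebesgue_integral)
qed

lemma keep_prob_eq:
  assumes "set_pmf P \<subseteq> {1..}"
  shows "keep_prob P x = (LBINT y:{0..x}. 1 / x * survival P y)"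
  unfolding keep_prob_def survival_def infsum_pmf_eq_integral[OF assms] ..

lemma ennreal_keep_prob:
  assumes "set_pmf P \<subseteq> {1..}"
  shows "ennreal (keep_prob P x) = (\<integral>\<^sup>+y\<in>{0..x}. ennreal (1 / x * survival P y) \<partial>lborel)"
proof (cases "0 < x")
  case True
  have "set_integrable lborel {0..x} (\<lambda>y. 1 / x * survival P y)"
    unfolding set_integrable_def
    using True
    by (intro integrableI_bounded_set_indicator[where B = "1 / x"]) (auto simp: divide_right_mono)
  then show ?thesis
    unfolding keep_prob_eq[OF assms] set_lebesgue_integral_def set_integrable_def using True
    by (subst nn_integral_eq_integral[symmetric])
      (auto intro!: nn_integral_cong split: split_indicator)
next
  case False
  \<comment> \<open>For \<open>x = 0\<close> the factor \<open>1 / x\<close> is 0 by convention, and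
    for \<open>x < 0\<close> the interval is empty; both sides vanish.\<close>
  then have "{0..x} \<subseteq> {0}" "x = 0 \<or> {0..x} = {}" by auto
  then show ?thesis
    by (auto simp: keep_prob_eq[OF assms] set_lebesgue_integral_def)
qed

lemma keep_prob_nonneg [simp]:
  assumes "set_pmf P \<subseteq> {1..}"
  shows "0 \<le> keep_prob P x"
  unfolding keep_prob_eq[OF assms] set_lebesgue_integral_def
  by (intro Bochner_Integration.integral_nonneg) (auto split: split_indicator)

lemma keep_prob_le_1:
  assumes "set_pmf P \<subseteq> {1..}"
  shows "keep_prob P x \<le> 1"
proof (cases "0 < x")
  case True
  have "ennreal (keep_prob P x) \<le> (\<integral>\<^sup>+y\<in>{0..x}. ennreal (1 / x) \<partial>lborel)"
    unfolding ennreal_keep_prob[OF assms] using True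
    by (intro nn_integral_mono) (auto split: split_indicator intro!: ennreal_leI divide_right_mono)
  also have "\<dots> = 1"
    using True by (simp add: nn_integral_cmult_indicator ennreal_mult[symmetric])
  finally show ?thesis
    by (simp add: ennreal_le_1)
next
  case False
  then have "{0..x} \<subseteq> {0}" "x = 0 \<or> {0..x} = {}" by auto
  then show ?thesis
    by (auto simp: keep_prob_eq[OF assms] set_lebesgue_integral_def)
qed

lemma keep_prob_measurable [measurable]:
  assumes "set_pmf P \<subseteq> {1..}"
  shows "keep_prob P \<in> borel_measurable borel"
proof -
  have "keep_prob P = (\<lambda>x. LBINT y. (if 0 \<le> y \<and> y \<le> x then 1 / x * survival P y else 0))"
    unfolding keep_prob_eq[OF assms] set_lebesgue_integral_def
    by (intro ext Bochner_Integration.integral_cong) (auto split: split_indicator)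
  then show ?thesis by simp
qed

section \<open>Uniform costs on an interval\<close>

definition uniform_cdf :: "real \<Rightarrow> real \<Rightarrow> real" where
  "uniform_cdf x w = max 0 (min w x) / x"

text \<open>The closed form makes the probability jointly measurable in the length of the interval
  and in the threshold, both of which become integration variables.\<close>

lemma uniform_cdf_measurable [measurable]:
  assumes [measurable]: "f \<in> borel_measurable N" "g \<in> borel_measurable N"
  shows "(\<lambda>\<omega>. uniform_cdf (f \<omega>) (g \<omega>)) \<in> borel_measurable N"
  unfolding uniform_cdf_def by measurable

lemma uniform_cdf_nonneg: "0 < x \<Longrightarrow> 0 \<le> uniform_cdf x w"
  by (simp add: uniform_cdf_def)

lemma uniform_cdf_le_1: "0 < x \<Longrightarrow> uniform_cdf x w \<le> 1"
  by (simp add: uniform_cdf_def)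

lemma prob_space_uniform_Icc: "0 < (x::real) \<Longrightarrow> prob_space (uniform_measure lborel {0..x})"
  by (rule prob_space_uniform_measure) auto

lemma emeasure_uniform_lessThan:
  assumes "0 < x"
  shows "emeasure (uniform_measure lborel {0..x}) {..<w} = ennreal (uniform_cdf x w)"
proof -
  have "{0..x} \<inter> {..<w} = (if w \<le> x then {0..<w} else {0..x})"
    by auto
  then show ?thesis
    using assms by (auto simp: uniform_cdf_def divide_ennreal max_def min_def)
qed

lemma emeasure_uniform_atLeast:
  assumes "0 < x"
  shows "emeasure (uniform_measure lborel {0..x}) {w..} = ennreal (1 - uniform_cdf x w)"
proof -
  interpret prob_space "uniform_measure lborel {0..x}"
    using assms by (rule prob_space_uniform_Icc)
  have "{w..} = space (uniform_measure lborel {0..x}) - {..<w}"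
    by auto
  then have "emeasure (uniform_measure lborel {0..x}) {w..} =
      1 - emeasure (uniform_measure lborel {0..x}) {..<w}"
    by (metis emeasure_compl emeasure_space_1 emeasure_finite lessThan_borel
        infinity_ennreal_def sets_lborel sets_uniform_measure)
  then show ?thesis
    using uniform_cdf_nonneg[OF assms]
    by (simp only: emeasure_uniform_lessThan[OF assms] ennreal_1[symmetric] ennreal_minus)
qed

text \<open>A cost \<open>y\<close> is below \<open>w\<close> iff \<open>w\<close> exceeds
  \<open>y\<close>. In this form, averaging over a random \<open>w\<close> yields the tail of
  \<open>w\<close> at \<open>y\<close>, which is how the Erlang tails get into
  \<open>keep_prob\<close>.\<close>

lemma ennreal_uniform_cdf:
  assumes "0 < x"
  shows "ennreal (uniform_cdf x w) =
    (\<integral>\<^sup>+y. ennreal (1 / x) * indicator {0..x} y * indicator {y<..} w \<partial>lborel)"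
proof -
  have "(\<integral>\<^sup>+y. ennreal (1 / x) * indicator {0..x} y * indicator {y<..} w \<partial>lborel) =
      (\<integral>\<^sup>+y. ennreal (1 / x) * indicator ({0..x} \<inter> {..<w}) y \<partial>lborel)"
    by (intro nn_integral_cong) (auto split: split_indicator)
  also have "\<dots> = ennreal (1 / x) * emeasure lborel ({0..x} \<inter> {..<w})"
    by (simp add: nn_integral_cmult_indicator)
  also have "{0..x} \<inter> {..<w} = (if w \<le> x then {0..<w} else {0..x})"
    by auto
  finally show ?thesis
    using assms by (auto simp: uniform_cdf_def max_def min_def ennreal_mult[symmetric])
qed

section \<open>Conditional probabilities and countable decompositions\<close>

lemma real_cond_exp_indicator_charact:
  assumes M: "finite_measure M" and sub: "subalgebra M F" and A [measurable]: "A \<in> sets M"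
    and g [measurable]: "g \<in> borel_measurable F" and g01: "\<And>\<omega>. 0 \<le> g \<omega>" "\<And>\<omega>. g \<omega> \<le> (1::real)"
    and eq: "\<And>B. B \<in> sets F \<Longrightarrow> emeasure M (A \<inter> B) = (\<integral>\<^sup>+\<omega>\<in>B. ennreal (g \<omega>) \<partial>M)"
  shows "AE \<omega> in M. real_cond_exp M F (indicator A) \<omega> = g \<omega>"
proof -
  interpret finite_measure_subalgebra M F
    using M sub by (simp add: finite_measure_subalgebra_def finite_measure_subalgebra_axioms_def)
  have gM [measurable]: "g \<in> borel_measurable M"
    using measurable_from_subalg[OF sub g] .
  show ?thesis
  \<comment> \<open>The hypothesis \<open>eq\<close> is the averaging property in
    \<open>ennreal\<close>; the bounds on \<open>g\<close> give the integrability needed to pass to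
    real integrals.\<close>
  proof (rule real_cond_exp_charact[OF _ _ _ g])
    show "integrable M (indicator A :: _ \<Rightarrow> real)"
      by (simp add: integrable_indicator_iff emeasure_eq_measure)
    show "integrable M g"
      using g01 by (intro integrable_const_bound[where B = 1]) auto
    fix B assume B: "B \<in> sets F"
    then have [measurable]: "B \<in> sets M"
      using sub by (auto simp: subalgebra_def)
    have "(\<integral>\<omega>\<in>B. indicator A \<omega> \<partial>M) = (\<integral>\<omega>. indicator (A \<inter> B) \<omega> \<partial>M)"
      unfolding set_lebesgue_integral_def
      by (intro Bochner_Integration.integral_cong) (auto split: split_indicator)
    also have "\<dots> = enn2real (emeasure M (A \<inter> B))"
      by (simp add: measure_def)
    also have "\<dots> = enn2real (\<integral>\<^sup>+\<omega>\<in>B. ennreal (g \<omega>) \<partial>M)"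
      by (simp add: eq[OF B])
    also have "\<dots> = (\<integral>\<omega>\<in>B. g \<omega> \<partial>M)"
      unfolding set_lebesgue_integral_def using g01
      by (subst integral_eq_nn_integral)
        (auto intro!: arg_cong[where f = enn2real] nn_integral_cong split: split_indicator)
    finally show "(\<integral>\<omega>\<in>B. indicator A \<omega> \<partial>M) = (\<integral>\<omega>\<in>B. g \<omega> \<partial>M)" .
  qed
qed

text \<open>Exactly one of the events \<open>h \<omega> = m\<close> occurs at each point. With
  \<open>h\<close> the degree, this replaces a random degree by a fixed \<open>m\<close>, for which
  the positions \<open>{1..m}\<close> no longer depend on chance.\<close>

lemma nn_integral_split_countable:
  fixes h :: "'a \<Rightarrow> nat"
  assumes [measurable]: "h \<in> measurable M (count_space UNIV)" "f \<in> borel_measurable M"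
  shows "(\<integral>\<^sup>+\<omega>. f \<omega> \<partial>M) = (\<Sum>m. \<integral>\<^sup>+\<omega>. f \<omega> * indicator {\<omega>. h \<omega> = m} \<omega> \<partial>M)"
proof -
  have "f \<omega> = (\<Sum>m. f \<omega> * indicator {\<omega>. h \<omega> = m} \<omega>)" for \<omega>
    by (rule suminf_cmult_indicator[symmetric, where i = "h \<omega>"]) (auto simp: disjoint_family_on_def)
  then have "(\<integral>\<^sup>+\<omega>. f \<omega> \<partial>M) = (\<integral>\<^sup>+\<omega>. (\<Sum>m. f \<omega> * indicator {\<omega>. h \<omega> = m} \<omega>) \<partial>M)"
    by simp
  also have "\<dots> = (\<Sum>m. \<integral>\<^sup>+\<omega>. f \<omega> * indicator {\<omega>. h \<omega> = m} \<omega> \<partial>M)"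
    by (rule nn_integral_suminf) measurable
  finally show ?thesis .
qed

lemma nn_integral_pmf_nat:
  fixes f :: "nat \<Rightarrow> ennreal"
  shows "(\<integral>\<^sup>+k. f k \<partial>measure_pmf P) = (\<Sum>k. ennreal (pmf P k) * f k)"
  by (simp add: nn_integral_measure_pmf nn_integral_count_space_nat)

lemma emeasure_Collect_eq_nn_integral:
  assumes "{x \<in> space M. Q x} \<in> sets M"
  shows "emeasure M {x \<in> space M. Q x} = (\<integral>\<^sup>+x. of_bool (Q x) \<partial>M)"
proof -
  have "emeasure M {x \<in> space M. Q x} = (\<integral>\<^sup>+x. indicator {x \<in> space M. Q x} x \<partial>M)"
    using assms by simp
  also have "\<dots> = (\<integral>\<^sup>+x. of_bool (Q x) \<partial>M)"
    by (intro nn_integral_cong) (simp add: indicator_def)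
  finally show ?thesis .
qed

lemma borel_measurable_of_bool:
  assumes "Measurable.pred M Q"
  shows "(\<lambda>x. of_bool (Q x) :: ennreal) \<in> borel_measurable M"
  using assms unfolding of_bool_def by measurable

text \<open>Exactly one subset of \<open>{1..m}\<close> equals the set of satisfied indices. This
  splits the event of \<open>d\<close> kept edges into events with a prescribed pattern.\<close>

lemma sum_subsets_indicator:
  fixes m d :: nat
  shows "(\<Sum>J | J \<subseteq> {1..m} \<and> card J = d. of_bool ({j \<in> {1..m}. Q j} = J)) =
    (of_bool (card {j \<in> {1..m}. Q j} = d) :: ennreal)"
proof (cases "card {j \<in> {1..m}. Q j} = d")
  case True
  have "finite {J. J \<subseteq> {1..m} \<and> card J = d}"
    by (rule finite_subset[of _ "Pow {1..m}"]) auto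
  moreover have "{j \<in> {1..m}. Q j} \<in> {J. J \<subseteq> {1..m} \<and> card J = d}"
    using True by auto
  ultimately show ?thesis
    using True by (simp add: of_bool_def sum.delta')
next
  case False
  then have "(\<Sum>J | J \<subseteq> {1..m} \<and> card J = d. of_bool ({j \<in> {1..m}. Q j} = J)) = (0::ennreal)"
    by (intro sum.neutral) auto
  then show ?thesis using False by simp
qed

section \<open>Laws of the marks\<close>

lemma fst_mark_measurable [measurable]: "fst \<in> measurable mark_space (count_space UNIV)"
  unfolding mark_space_def by measurable

lemma fst_snd_mark_measurable [measurable]: "(\<lambda>k. fst (snd k)) \<in> borel_measurable mark_space"
  unfolding mark_space_def by measurable

lemma snd_snd_mark_measurable [measurable]: "(\<lambda>k. snd (snd k) j) \<in> borel_measurable mark_space"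
proof -
  have "(\<lambda>k. snd (snd k)) \<in> measurable mark_space (\<Pi>\<^sub>M j\<in>UNIV. borel)"
    unfolding mark_space_def by measurable
  then show ?thesis
    by (rule measurable_compose) simp
qed

context erlang_weighted_tree
begin

text \<open>Indices outside \<open>words\<close> are redirected to the root, so that every mark has a law.\<close>

definition mark_at :: "nat list \<Rightarrow> 'w \<Rightarrow> nat \<times> real \<times> (nat \<Rightarrow> real)" where
  "mark_at i \<omega> = mark (n \<omega>) (v \<omega>) (\<zeta> \<omega>) (if i \<in> words then i else [])"

definition mark_distr :: "nat list \<Rightarrow> (nat \<times> real \<times> (nat \<Rightarrow> real)) measure" where
  "mark_distr i = distr M mark_space (mark_at i)"

lemma mark_at_measurable [measurable]: "mark_at i \<in> measurable M mark_space"
  using marks_indep unfolding indep_vars_def mark_at_def[abs_def] by auto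

lemma sets_mark_distr [simp, measurable_cong]: "sets (mark_distr i) = sets mark_space"
  by (simp add: mark_distr_def)

lemma space_mark_distr [simp]: "space (mark_distr i) = space mark_space"
  by (simp add: mark_distr_def)

lemma prob_space_mark_distr: "prob_space (mark_distr i)"
  unfolding mark_distr_def by (rule prob_space_distr) measurable

lemma fst_mark_at: "i \<in> words \<Longrightarrow> fst (mark_at i \<omega>) = n \<omega> i"
  and fst_snd_mark_at: "i \<in> words \<Longrightarrow> fst (snd (mark_at i \<omega>)) = v \<omega> i"
  and snd_snd_mark_at:
    "i \<in> words \<Longrightarrow> 1 \<le> j \<Longrightarrow> j \<le> n \<omega> i \<Longrightarrow> snd (snd (mark_at i \<omega>)) j = \<zeta> \<omega> (i @ [j])"
  by (simp_all add: mark_at_def mark_def)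

lemma degree_measurable [measurable]:
  assumes "i \<in> words"
  shows "(\<lambda>\<omega>. n \<omega> i) \<in> measurable M (count_space UNIV)"
proof -
  have "(\<lambda>\<omega>. fst (mark_at i \<omega>)) \<in> measurable M (count_space UNIV)"
    by measurable
  then show ?thesis by (simp add: fst_mark_at[OF assms])
qed

lemma parameter_measurable [measurable]:
  assumes "i \<in> words"
  shows "(\<lambda>\<omega>. v \<omega> i) \<in> borel_measurable M"
proof -
  have "(\<lambda>\<omega>. fst (snd (mark_at i \<omega>))) \<in> borel_measurable M"
    by measurable
  then show ?thesis by (simp add: fst_snd_mark_at[OF assms])
qed

text \<open>Independence in the form needed for iterated integration over the marks of
  \<open>i\<close>, its ancestors and its potential children.\<close>

lemma distr_marks:
  assumes "F \<noteq> {}" "F \<subseteq> words"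
  shows "distr M (Pi\<^sub>M F (\<lambda>_. mark_space)) (\<lambda>\<omega>. \<lambda>i\<in>F. mark_at i \<omega>) = Pi\<^sub>M F mark_distr"
proof -
  have "indep_vars (\<lambda>_. mark_space) (\<lambda>i \<omega>. mark (n \<omega>) (v \<omega>) (\<zeta> \<omega>) i) F"
    using marks_indep assms(2) by (rule indep_vars_subset)
  also have "?this \<longleftrightarrow> indep_vars (\<lambda>_. mark_space) mark_at F"
    using assms(2) by (intro indep_vars_cong) (auto simp: mark_at_def fun_eq_iff)
  finally show ?thesis
    using assms(1) by (simp add: indep_vars_iff_distr_eq_PiM mark_distr_def[abs_def])
qed

text \<open>When the degree is \<open>m\<close>, the positions 1 to \<open>m\<close> of a mark are
  not masked, so conditions on the mark are conditions on the costs and \<open>mark_law\<close>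
  applies.\<close>

lemma emeasure_mark_distr:
  assumes i: "i \<in> words" and [measurable]: "B \<in> sets borel" "\<And>j. C j \<in> sets borel"
  shows "emeasure (mark_distr i)
      {k \<in> space mark_space. fst k = m \<and> fst (snd k) \<in> B \<and> (\<forall>j\<in>{1..m}. snd (snd k) j \<in> C j)} =
    ennreal (potential_degree_prob P i m) *
      (\<integral>\<^sup>+x\<in>B. ennreal (erlang_density m 1 x) *
        (\<Prod>j=1..m. emeasure (uniform_measure lborel {0..x}) (C j)) \<partial>lborel)"
proof -
  have "emeasure (mark_distr i)
      {k \<in> space mark_space. fst k = m \<and> fst (snd k) \<in> B \<and> (\<forall>j\<in>{1..m}. snd (snd k) j \<in> C j)} =
    emeasure M (mark_at i -` {k \<in> space mark_space. fst k = m \<and> fst (snd k) \<in> B \<and>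
      (\<forall>j\<in>{1..m}. snd (snd k) j \<in> C j)} \<inter> space M)"
    unfolding mark_distr_def by (rule emeasure_distr) measurable
  also have "mark_at i -` {k \<in> space mark_space. fst k = m \<and> fst (snd k) \<in> B \<and>
      (\<forall>j\<in>{1..m}. snd (snd k) j \<in> C j)} \<inter> space M =
    {\<omega> \<in> space M. n \<omega> i = m \<and> v \<omega> i \<in> B \<and> (\<forall>j\<in>{1..m}. \<zeta> \<omega> (i @ [j]) \<in> C j)}"
    using measurable_space[OF mark_at_measurable[of i]] i
    by (auto simp: fst_mark_at fst_snd_mark_at snd_snd_mark_at)
  finally show ?thesis
    using mark_law[OF i assms(2,3)] by simp
qed

section \<open>The law of the type of a vertex\<close>

lemma emeasure_type:
  assumes i: "i \<in> words" and [measurable]: "B \<in> sets borel"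
  shows "emeasure M {\<omega> \<in> space M. n \<omega> i = m \<and> v \<omega> i \<in> B} =
    ennreal (potential_degree_prob P i m) * (\<integral>\<^sup>+x\<in>B. ennreal (erlang_density m 1 x) \<partial>lborel)"
proof -
  have "emeasure M {\<omega> \<in> space M. n \<omega> i = m \<and> v \<omega> i \<in> B} = ennreal (potential_degree_prob P i m) *
      (\<integral>\<^sup>+x\<in>B. ennreal (erlang_density m 1 x) *
        (\<Prod>j=1..m. emeasure (uniform_measure lborel {0..x}) UNIV) \<partial>lborel)"
    using mark_law[OF i assms(2), of "\<lambda>_. UNIV" m] by simp
  also have "(\<integral>\<^sup>+x\<in>B. ennreal (erlang_density m 1 x) *
        (\<Prod>j=1..m. emeasure (uniform_measure lborel {0..x}) UNIV) \<partial>lborel) =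
      (\<integral>\<^sup>+x\<in>B. ennreal (erlang_density m 1 x) \<partial>lborel)"
  \<comment> \<open>For \<open>x > 0\<close> the uniform laws have total mass 1; for
    \<open>x < 0\<close> the Erlang density is 0. The point \<open>x = 0\<close>, where
    \<open>{0..x}\<close> has length 0, is removed as a null set.\<close>
  proof (intro nn_integral_cong_AE)
    have "ennreal (erlang_density m 1 x) *
        (\<Prod>j=1..m. emeasure (uniform_measure lborel {0..x}) UNIV) = ennreal (erlang_density m 1 x)"
      if "x \<noteq> 0" for x
    proof (cases "0 < x")
      case True
      then interpret U: prob_space "uniform_measure lborel {0..x}"
        by (rule prob_space_uniform_Icc)
      show ?thesis
        using U.emeasure_space_1 by simp
    qed (use that in \<open>simp add: erlang_density_neg\<close>)
    then show "AE x in lborel. ennreal (erlang_density m 1 x) *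
        (\<Prod>j=1..m. emeasure (uniform_measure lborel {0..x}) UNIV) * indicator B x =
        ennreal (erlang_density m 1 x) * indicator B x"
      using AE_lborel_singleton[of 0] by (auto elim!: eventually_mono)
  qed
  finally show ?thesis .
qed

text \<open>\<open>emeasure_type\<close> gives the law on sets. Hence the image under
  \<open>v\<close> of \<open>M\<close> restricted to degree \<open>m\<close> is a measure with a
  known density, and integrals of nonnegative functions follow.\<close>

lemma nn_integral_type_eq:
  assumes i: "i \<in> words" and f [measurable]: "f \<in> borel_measurable borel"
  shows "(\<integral>\<^sup>+\<omega>. f (v \<omega> i) * indicator {\<omega>. n \<omega> i = m} \<omega> \<partial>M) =
    ennreal (potential_degree_prob P i m) * (\<integral>\<^sup>+x. ennreal (erlang_density m 1 x) * f x \<partial>lborel)"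
proof -
  note [measurable] = degree_measurable[OF i] parameter_measurable[OF i]
  let ?N = "density M (indicator {\<omega>. n \<omega> i = m})"
  let ?K = "density lborel (\<lambda>x. ennreal (potential_degree_prob P i m) * ennreal (erlang_density m 1 x))"
  have ind [measurable]: "indicator {\<omega>. n \<omega> i = m} \<in> borel_measurable M"
    by measurable
  have "distr ?N borel (\<lambda>\<omega>. v \<omega> i) = ?K"
  proof (rule measure_eqI)
    fix B assume "B \<in> sets (distr ?N borel (\<lambda>\<omega>. v \<omega> i))"
    then have [measurable]: "B \<in> sets borel" by simp
    have "emeasure (distr ?N borel (\<lambda>\<omega>. v \<omega> i)) B =
        emeasure M {\<omega> \<in> space M. n \<omega> i = m \<and> v \<omega> i \<in> B}"
      by (subst emeasure_distr, measurable, subst emeasure_density, measurable, measurable,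
          subst emeasure_Collect_eq_nn_integral, measurable)
        (auto intro!: nn_integral_cong split: split_indicator)
    also have "\<dots> = emeasure ?K B"
      by (simp add: emeasure_type[OF i] emeasure_density mult.assoc nn_integral_cmult)
    finally show "emeasure (distr ?N borel (\<lambda>\<omega>. v \<omega> i)) B = emeasure ?K B" .
  qed simp
  then have "(\<integral>\<^sup>+x. f x \<partial>distr ?N borel (\<lambda>\<omega>. v \<omega> i)) = (\<integral>\<^sup>+x. f x \<partial>?K)"
    by simp
  then show ?thesis
    by (simp add: nn_integral_distr nn_integral_density mult.assoc nn_integral_cmult mult.commute[of "f _"])
qed

lemma nn_integral_type:
  assumes i: "i \<in> words" and [measurable]: "\<And>m. f m \<in> borel_measurable borel"
  shows "(\<integral>\<^sup>+\<omega>. f (n \<omega> i) (v \<omega> i) \<partial>M) = (\<Sum>m. ennreal (potential_degree_prob P i m) *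
    (\<integral>\<^sup>+x. ennreal (erlang_density m 1 x) * f m x \<partial>lborel))"
proof -
  note [measurable] = degree_measurable[OF i] parameter_measurable[OF i]
  have [measurable]: "(\<lambda>\<omega>. f (n \<omega> i) (v \<omega> i)) \<in> borel_measurable M"
    by (rule measurable_compose_countable'[where I = UNIV and f = "\<lambda>m \<omega>. f m (v \<omega> i)"]) auto
  have "(\<integral>\<^sup>+\<omega>. f (n \<omega> i) (v \<omega> i) \<partial>M) =
      (\<Sum>m. \<integral>\<^sup>+\<omega>. f (n \<omega> i) (v \<omega> i) * indicator {\<omega>. n \<omega> i = m} \<omega> \<partial>M)"
    by (rule nn_integral_split_countable) measurable
  also have "(\<lambda>m. \<integral>\<^sup>+\<omega>. f (n \<omega> i) (v \<omega> i) * indicator {\<omega>. n \<omega> i = m} \<omega> \<partial>M) =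
      (\<lambda>m. \<integral>\<^sup>+\<omega>. f m (v \<omega> i) * indicator {\<omega>. n \<omega> i = m} \<omega> \<partial>M)"
    by (intro ext nn_integral_cong) (auto split: split_indicator)
  finally show ?thesis
    by (simp add: nn_integral_type_eq[OF i])
qed

lemma nn_integral_root_type:
  assumes [measurable]: "\<And>m. f m \<in> borel_measurable borel"
  shows "(\<integral>\<^sup>+\<omega>. f (n \<omega> []) (v \<omega> []) \<partial>M) =
    (\<integral>\<^sup>+m. (\<integral>\<^sup>+x. ennreal (erlang_density m 1 x) * f m x \<partial>lborel) \<partial>measure_pmf P)"
  by (subst nn_integral_type) (simp_all add: nn_integral_pmf_nat potential_degree_prob_def)

section \<open>Tails of the children's parameters and the probability of keeping an edge\<close>

lemma emeasure_parameter_greater: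
  assumes P: "set_pmf P \<subseteq> {1..}" and c: "c \<in> words" "c \<noteq> []"
  shows "emeasure M {\<omega> \<in> space M. y < v \<omega> c} = ennreal (survival P y)"
proof -
  note [measurable] = degree_measurable[OF c(1)] parameter_measurable[OF c(1)]
  have "emeasure M {\<omega> \<in> space M. y < v \<omega> c} = (\<integral>\<^sup>+\<omega>. indicator {y<..} (v \<omega> c) \<partial>M)"
    by (subst emeasure_Collect_eq_nn_integral) (simp_all add: indicator_def)
  also have "\<dots> = (\<Sum>m. ennreal (pmf P (m + 1)) * ennreal (erlang_ccdf (m + 1) y))"
    using c(2) unfolding nn_integral_type[OF c(1), where f = "\<lambda>_. indicator {y<..}", simplified]
    by (simp add: potential_degree_prob_def ennreal_erlang_ccdf_eq)
  also have "\<dots> = (\<Sum>k. ennreal (pmf P k) * ennreal (erlang_ccdf k y))"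
  proof -
    \<comment> \<open>Shifting the index from \<open>m + 1\<close> to \<open>k\<close> adds the term
      \<open>k = 0\<close>, which vanishes because \<open>P\<close> lives on
      \<open>{1..}\<close>.\<close>
    have "pmf P 0 = 0"
      using P by (auto simp: set_pmf_iff)
    then show ?thesis
      by (subst (2) suminf_offset[where i = 1]) simp_all
  qed
  finally show ?thesis
    by (simp add: ennreal_survival nn_integral_pmf_nat)
qed

text \<open>The integrand is the probability that a uniform cost on \<open>[0, x]\<close> is below
  the parameter of \<open>c\<close>. Written as an integral over \<open>y\<close>, Tonelli's theorem
  leaves the tail of \<open>v c\<close> at \<open>y\<close>, which is \<open>survival P y\<close>
  because \<open>c\<close> is not the root.\<close>

lemma nn_integral_uniform_cdf:
  assumes P: "set_pmf P \<subseteq> {1..}" and c: "c \<in> words" "c \<noteq> []" and x: "0 < x"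
  shows "(\<integral>\<^sup>+k. ennreal (uniform_cdf x (fst (snd k))) \<partial>mark_distr c) = ennreal (keep_prob P x)"
proof -
  note [measurable] = parameter_measurable[OF c(1)]
  interpret pair_sigma_finite M lborel
    by standard
  have "(\<integral>\<^sup>+k. ennreal (uniform_cdf x (fst (snd k))) \<partial>mark_distr c) =
      (\<integral>\<^sup>+\<omega>. (\<integral>\<^sup>+y. ennreal (1 / x) * indicator {0..x} y * (if y < v \<omega> c then 1 else 0) \<partial>lborel) \<partial>M)"
    using x c by (simp add: mark_distr_def nn_integral_distr fst_snd_mark_at ennreal_uniform_cdf
        indicator_def of_bool_def)
  also have "\<dots> =
      (\<integral>\<^sup>+y. (\<integral>\<^sup>+\<omega>. ennreal (1 / x) * indicator {0..x} y * (if y < v \<omega> c then 1 else 0) \<partial>M) \<partial>lborel)"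
    by (rule Fubini'[symmetric]) measurable
  also have "\<dots> = (\<integral>\<^sup>+y\<in>{0..x}. ennreal (1 / x * survival P y) \<partial>lborel)"
  proof (intro nn_integral_cong)
    fix y
    have "(\<integral>\<^sup>+\<omega>. (if y < v \<omega> c then 1 else 0) \<partial>M) = emeasure M {\<omega> \<in> space M. y < v \<omega> c}"
      by (subst emeasure_Collect_eq_nn_integral) (simp_all add: of_bool_def)
    then show "(\<integral>\<^sup>+\<omega>. ennreal (1 / x) * indicator {0..x} y * (if y < v \<omega> c then 1 else 0) \<partial>M) =
        ennreal (1 / x * survival P y) * indicator {0..x} y"
      using x ennreal_mult'[of "1 / x" "survival P y"] by (subst nn_integral_cmult)
        (simp_all add: emeasure_parameter_greater[OF P c] mult_ac)
  qed
  finally show ?thesis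
    by (simp add: ennreal_keep_prob[OF P])
qed

lemma nn_integral_one_minus_uniform_cdf:
  assumes P: "set_pmf P \<subseteq> {1..}" and c: "c \<in> words" "c \<noteq> []" and x: "0 < x"
  shows "(\<integral>\<^sup>+k. ennreal (1 - uniform_cdf x (fst (snd k))) \<partial>mark_distr c) = ennreal (1 - keep_prob P x)"
proof -
  interpret L: prob_space "mark_distr c"
    by (rule prob_space_mark_distr)
  have "(\<integral>\<^sup>+k. ennreal (1 - uniform_cdf x (fst (snd k))) \<partial>mark_distr c) =
      (\<integral>\<^sup>+k. 1 - ennreal (uniform_cdf x (fst (snd k))) \<partial>mark_distr c)"
    using uniform_cdf_nonneg[OF x]
    by (intro nn_integral_cong) (simp add: ennreal_minus[symmetric])
  also have "\<dots> = (\<integral>\<^sup>+k. 1 \<partial>mark_distr c) - (\<integral>\<^sup>+k. ennreal (uniform_cdf x (fst (snd k))) \<partial>mark_distr c)"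
    using uniform_cdf_le_1[OF x]
    by (intro nn_integral_diff) (auto simp: nn_integral_uniform_cdf[OF P c x] ennreal_le_1)
  also have "\<dots> = ennreal (1 - keep_prob P x)"
    using P L.emeasure_space_1
    by (simp add: nn_integral_uniform_cdf[OF P c x] ennreal_minus[symmetric])
  finally show ?thesis .
qed

text \<open>
  The mark of \<open>i\<close> is integrated out first, with the parameters of its children held fixed: the
  prescribed pattern of kept edges is then a rectangle in the costs, so that the product formula
  \<open>mark_law\<close> applies directly.  The marks in \<open>A\<close> (the ancestors of \<open>i\<close>) only enter through \<open>S\<close>.
\<close>

lemma emeasure_kept_pattern:
  fixes m :: nat
  assumes P: "set_pmf P \<subseteq> {1..}" and i: "i \<in> words"
    and A: "finite A" "A \<subseteq> words" "i \<notin> A" "\<And>j. i @ [j] \<notin> A"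
    and J: "J \<subseteq> {1..m}"
    and S [measurable]: "S \<in> sets (Pi\<^sub>M A (\<lambda>_. mark_space) \<Otimes>\<^sub>M borel)"
  shows "emeasure M {\<omega> \<in> space M. (\<lambda>a\<in>A. mark_at a \<omega>, v \<omega> i) \<in> S \<and> n \<omega> i = m \<and>
      {j \<in> {1..m}. \<zeta> \<omega> (i @ [j]) < v \<omega> (i @ [j])} = J} =
    (\<integral>\<^sup>+y. ennreal (potential_degree_prob P i m) * (\<integral>\<^sup>+x. ennreal (erlang_density m 1 x) *
      (indicator S (y, x) * ennreal (keep_prob P x ^ card J * (1 - keep_prob P x) ^ (m - card J))) \<partial>lborel)
      \<partial>Pi\<^sub>M A mark_distr)"
proof -
  \<comment> \<open>The relevant marks form three blocks: \<open>i\<close> itself, the potential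
    children \<open>C\<close> and the vertices in \<open>A\<close>. They are disjoint, so the joint
    law is a product.\<close>
  define C where "C = (\<lambda>j. i @ [j]) ` {1..m}"
  define w where "w z j = fst (snd (z (i @ [j])))" for z :: "nat list \<Rightarrow> nat \<times> real \<times> (nat \<Rightarrow> real)" and j
  \<comment> \<open>\<open>Q\<close> reads \<open>z\<close> at ancestors and children only and takes
    the mark \<open>k\<close> of \<open>i\<close> separately, so that \<open>k\<close> can be
    integrated with \<open>z\<close> fixed.\<close>
  define Q where "Q z k \<longleftrightarrow> fst k = m \<and> (restrict z A, fst (snd k)) \<in> S \<and>
    (\<forall>j\<in>{1..m}. snd (snd k) j < w z j \<longleftrightarrow> j \<in> J)"
    for z :: "nat list \<Rightarrow> nat \<times> real \<times> (nat \<Rightarrow> real)" and k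
  \<comment> \<open>For \<open>x > 0\<close> this is the probability that a uniform cost on
    \<open>[0, x]\<close> gives edge \<open>j\<close> the status prescribed by \<open>J\<close> when
    the child has parameter \<open>u\<close>.\<close>
  define h where "h j x u = (if j \<in> J then uniform_cdf x u else 1 - uniform_cdf x u)" for j :: nat and x u
  have h [measurable]: "(\<lambda>\<omega>. h j (f \<omega>) (g \<omega>)) \<in> borel_measurable N"
    if [measurable]: "f \<in> borel_measurable N" "g \<in> borel_measurable N" for j f g and N :: "'z measure"
    unfolding h_def by measurable
  have h_nonneg: "0 \<le> h j x u" if "0 < x" for j x u
    using that uniform_cdf_nonneg uniform_cdf_le_1 by (simp add: h_def)
  have C: "finite C" "C \<subseteq> words" "i \<notin> C" "A \<inter> C = {}" "[] \<notin> C" "\<And>j. j \<in> {1..m} \<Longrightarrow> i @ [j] \<in> C"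
    using i A by (auto simp: C_def)
  interpret L: product_sigma_finite mark_distr
    unfolding product_sigma_finite_def
    by (intro allI prob_space_imp_sigma_finite prob_space_mark_distr)
  interpret CL: prob_space "Pi\<^sub>M C mark_distr"
    by (intro prob_space_PiM prob_space_mark_distr)
  interpret xC: pair_sigma_finite lborel "Pi\<^sub>M C mark_distr"
    by standard
  have meas_w: "(\<lambda>z. w z j) \<in> borel_measurable (Pi\<^sub>M F (\<lambda>_. mark_space))"
    if "j \<in> {1..m}" "C \<subseteq> F" for j F
  proof -
    have "(\<lambda>z. z (i @ [j])) \<in> measurable (Pi\<^sub>M F (\<lambda>_. mark_space)) mark_space"
      using that C(6)[OF that(1)] by (intro measurable_component_singleton) auto
    from measurable_compose[OF this fst_snd_mark_measurable] show ?thesis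
      by (simp add: w_def)
  qed
  have Q_pred: "Measurable.pred (Pi\<^sub>M (insert i (A \<union> C)) (\<lambda>_. mark_space)) (\<lambda>z. Q z (z i))"
  proof -
    have [measurable]: "(\<lambda>z. z i) \<in> measurable (Pi\<^sub>M (insert i (A \<union> C)) (\<lambda>_. mark_space)) mark_space"
      by measurable
    have [measurable]: "(\<lambda>z. restrict z A) \<in>
        measurable (Pi\<^sub>M (insert i (A \<union> C)) (\<lambda>_. mark_space)) (Pi\<^sub>M A (\<lambda>_. mark_space))"
      by (rule measurable_restrict_subset) auto
    have "Measurable.pred (Pi\<^sub>M (insert i (A \<union> C)) (\<lambda>_. mark_space))
        (\<lambda>z. \<forall>j\<in>{1..m}. snd (snd (z i)) j < w z j \<longleftrightarrow> j \<in> J)"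
    proof (intro pred_intros_finite)
      fix j assume j: "j \<in> {1..m}"
      note [measurable] = meas_w[OF j, of "insert i (A \<union> C)"]
      have "C \<subseteq> insert i (A \<union> C)" by auto
      then show "Measurable.pred (Pi\<^sub>M (insert i (A \<union> C)) (\<lambda>_. mark_space))
          (\<lambda>z. snd (snd (z i)) j < w z j \<longleftrightarrow> j \<in> J)"
        by measurable
    qed simp
    then show ?thesis
      unfolding Q_def by measurable
  qed
  define f where "f z = (of_bool (Q z (z i)) :: ennreal)" for z
  have f [measurable]: "f \<in> borel_measurable (Pi\<^sub>M (insert i (A \<union> C)) (\<lambda>_. mark_space))"
    using Q_pred unfolding f_def of_bool_def by measurable
  have sets_PiM_L: "sets (Pi\<^sub>M F mark_distr) = sets (Pi\<^sub>M F (\<lambda>_. mark_space))" for F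
    by (intro sets_PiM_cong) auto
  have f' [measurable]: "f \<in> borel_measurable (Pi\<^sub>M (insert i (A \<union> C)) mark_distr)"
    using f by (simp cong: measurable_cong_sets add: sets_PiM_L)
  let ?X = "\<lambda>\<omega>. \<lambda>a\<in>insert i (A \<union> C). mark_at a \<omega>"
  have X [measurable]: "?X \<in> measurable M (Pi\<^sub>M (insert i (A \<union> C)) (\<lambda>_. mark_space))"
    by (intro measurable_restrict) measurable
  have f_X: "f (?X \<omega>) = of_bool ((\<lambda>a\<in>A. mark_at a \<omega>, v \<omega> i) \<in> S \<and> n \<omega> i = m \<and>
      {j \<in> {1..m}. \<zeta> \<omega> (i @ [j]) < v \<omega> (i @ [j])} = J)" for \<omega>
  proof -
    have "restrict (?X \<omega>) A = (\<lambda>a\<in>A. mark_at a \<omega>)"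
      by (auto simp: restrict_def fun_eq_iff)
    moreover have "w (?X \<omega>) j = v \<omega> (i @ [j])" if "j \<in> {1..m}" for j
      using that C(6)[OF that] i by (simp add: w_def fst_snd_mark_at)
    ultimately show ?thesis
      using J by (auto simp: f_def Q_def fst_mark_at fst_snd_mark_at snd_snd_mark_at i)
  qed
  have "emeasure M {\<omega> \<in> space M. (\<lambda>a\<in>A. mark_at a \<omega>, v \<omega> i) \<in> S \<and> n \<omega> i = m \<and>
      {j \<in> {1..m}. \<zeta> \<omega> (i @ [j]) < v \<omega> (i @ [j])} = J} = (\<integral>\<^sup>+\<omega>. f (?X \<omega>) \<partial>M)"
  proof -
    have "{\<omega> \<in> space M. (\<lambda>a\<in>A. mark_at a \<omega>, v \<omega> i) \<in> S \<and> n \<omega> i = m \<and>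
      {j \<in> {1..m}. \<zeta> \<omega> (i @ [j]) < v \<omega> (i @ [j])} = J} = {\<omega> \<in> space M. f (?X \<omega>) = 1}"
      unfolding f_X by auto
    also have "\<dots> \<in> sets M"
      by measurable
    finally show ?thesis
      unfolding f_X by (rule emeasure_Collect_eq_nn_integral)
  qed
  also have "\<dots> = (\<integral>\<^sup>+z. f z \<partial>Pi\<^sub>M (insert i (A \<union> C)) mark_distr)"
    using i A C by (subst distr_marks[symmetric]) (auto simp: nn_integral_distr)
  also have "\<dots> = (\<integral>\<^sup>+z. (\<integral>\<^sup>+k. f (z(i := k)) \<partial>mark_distr i) \<partial>Pi\<^sub>M (A \<union> C) mark_distr)"
    using A C by (intro L.product_nn_integral_insert) auto
  also have "\<dots> = (\<integral>\<^sup>+z. ennreal (potential_degree_prob P i m) * (\<integral>\<^sup>+x. ennreal (erlang_density m 1 x) *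
      (indicator S (restrict z A, x) * (\<Prod>j=1..m. ennreal (h j x (w z j)))) \<partial>lborel)
      \<partial>Pi\<^sub>M (A \<union> C) mark_distr)"
  proof (rule nn_integral_cong)
    fix z assume z: "z \<in> space (Pi\<^sub>M (A \<union> C) mark_distr)"
    define B where "B = Pair (restrict z A) -` S"
    \<comment> \<open>With the thresholds \<open>w z j\<close> fixed, the pattern \<open>J\<close>
      asks each cost to lie in a half-line, so the event is a rectangle in the costs.\<close>
    define D where "D j = (if j \<in> J then {..<w z j} else {w z j..})" for j
    have B [measurable]: "B \<in> sets borel"
      unfolding B_def using S by (rule sets_Pair1)
    have D [measurable]: "D j \<in> sets borel" for j
      by (simp add: D_def)
    have "f (z(i := k)) = of_bool (fst k = m \<and> fst (snd k) \<in> B \<and> (\<forall>j\<in>{1..m}. snd (snd k) j \<in> D j))" for k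
    proof -
      have "restrict (z(i := k)) A = restrict z A"
        using A(3) by (auto simp: restrict_def fun_eq_iff)
      moreover have "w (z(i := k)) j = w z j" for j
        by (simp add: w_def)
      ultimately show ?thesis
        by (auto simp: f_def Q_def B_def D_def split: if_splits)
    qed
    then have "(\<integral>\<^sup>+k. f (z(i := k)) \<partial>mark_distr i) = emeasure (mark_distr i)
        {k \<in> space (mark_distr i). fst k = m \<and> fst (snd k) \<in> B \<and> (\<forall>j\<in>{1..m}. snd (snd k) j \<in> D j)}"
      by (subst emeasure_Collect_eq_nn_integral) simp_all
    also have "\<dots> = ennreal (potential_degree_prob P i m) *
      (\<integral>\<^sup>+x\<in>B. ennreal (erlang_density m 1 x) *
        (\<Prod>j=1..m. emeasure (uniform_measure lborel {0..x}) (D j)) \<partial>lborel)"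
      using emeasure_mark_distr[OF i B D] by simp
    also have "(\<integral>\<^sup>+x\<in>B. ennreal (erlang_density m 1 x) *
        (\<Prod>j=1..m. emeasure (uniform_measure lborel {0..x}) (D j)) \<partial>lborel) =
      (\<integral>\<^sup>+x. ennreal (erlang_density m 1 x) *
        (indicator S (restrict z A, x) * (\<Prod>j=1..m. ennreal (h j x (w z j)))) \<partial>lborel)"
    proof (intro nn_integral_cong_AE)
      have "ennreal (erlang_density m 1 x) *
          (\<Prod>j=1..m. emeasure (uniform_measure lborel {0..x}) (D j)) * indicator B x =
        ennreal (erlang_density m 1 x) *
          (indicator S (restrict z A, x) * (\<Prod>j=1..m. ennreal (h j x (w z j))))" if "x \<noteq> 0" for x
      proof (cases "0 < x")
        case True
        have "emeasure (uniform_measure lborel {0..x}) (D j) = ennreal (h j x (w z j))" for j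
          by (cases "j \<in> J")
            (simp_all only: D_def h_def if_True if_False
              emeasure_uniform_lessThan[OF True] emeasure_uniform_atLeast[OF True])
        then show ?thesis
          by (simp add: B_def indicator_def)
      qed (use that in \<open>simp add: erlang_density_neg\<close>)
      then show "AE x in lborel. ennreal (erlang_density m 1 x) *
          (\<Prod>j=1..m. emeasure (uniform_measure lborel {0..x}) (D j)) * indicator B x =
        ennreal (erlang_density m 1 x) *
          (indicator S (restrict z A, x) * (\<Prod>j=1..m. ennreal (h j x (w z j))))"
        using AE_lborel_singleton[of 0] by (auto elim!: eventually_mono)
    qed
    finally show "(\<integral>\<^sup>+k. f (z(i := k)) \<partial>mark_distr i) = ennreal (potential_degree_prob P i m) *
      (\<integral>\<^sup>+x. ennreal (erlang_density m 1 x) *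
        (indicator S (restrict z A, x) * (\<Prod>j=1..m. ennreal (h j x (w z j)))) \<partial>lborel)" .
  qed
  also have "\<dots> = (\<integral>\<^sup>+y. (\<integral>\<^sup>+u. ennreal (potential_degree_prob P i m) * (\<integral>\<^sup>+x. ennreal (erlang_density m 1 x) *
      (indicator S (restrict (merge A C (y, u)) A, x) *
        (\<Prod>j=1..m. ennreal (h j x (w (merge A C (y, u)) j)))) \<partial>lborel)
      \<partial>Pi\<^sub>M C mark_distr) \<partial>Pi\<^sub>M A mark_distr)"
  \<comment> \<open>The integrand depends on the ancestors through \<open>S\<close> and on the
    children through the thresholds; folding the product measure separates the two blocks.\<close>
  proof (rule L.product_nn_integral_fold)
    have w' [measurable]: "(\<lambda>z. w z j) \<in> borel_measurable (Pi\<^sub>M (A \<union> C) mark_distr)" if "j \<in> {1..m}" for j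
      using meas_w[OF that, of "A \<union> C"] by (simp cong: measurable_cong_sets add: sets_PiM_L)
    have [measurable]: "(\<lambda>z. restrict z A) \<in>
        measurable (Pi\<^sub>M (A \<union> C) mark_distr) (Pi\<^sub>M A (\<lambda>_. mark_space))"
      using measurable_restrict_subset[of A "A \<union> C" mark_distr]
      by (simp cong: measurable_cong_sets add: sets_PiM_L)
    show "(\<lambda>z. ennreal (potential_degree_prob P i m) * (\<integral>\<^sup>+x. ennreal (erlang_density m 1 x) *
      (indicator S (restrict z A, x) * (\<Prod>j=1..m. ennreal (h j x (w z j)))) \<partial>lborel))
      \<in> borel_measurable (Pi\<^sub>M (A \<union> C) mark_distr)"
      by measurable
  qed (use A C in auto)
  also have "\<dots> = (\<integral>\<^sup>+y. ennreal (potential_degree_prob P i m) * (\<integral>\<^sup>+x. ennreal (erlang_density m 1 x) *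
      (indicator S (y, x) * ennreal (keep_prob P x ^ card J * (1 - keep_prob P x) ^ (m - card J))) \<partial>lborel)
      \<partial>Pi\<^sub>M A mark_distr)"
  proof (rule nn_integral_cong)
    fix y assume y: "y \<in> space (Pi\<^sub>M A mark_distr)"
    have restr: "restrict (merge A C (y, u)) A = y" for u
      using y by (auto simp: merge_def restrict_def fun_eq_iff space_PiM PiE_def extensional_def)
    have w_merge: "w (merge A C (y, u)) j = w u j" if "j \<in> {1..m}" for u j
      using C(6)[OF that] A(4) by (simp add: w_def merge_def)
    have w' [measurable]: "(\<lambda>z. w z j) \<in> borel_measurable (Pi\<^sub>M C mark_distr)" if "j \<in> {1..m}" for j
      using meas_w[OF that, of C] by (simp cong: measurable_cong_sets add: sets_PiM_L)
    have y': "y \<in> space (Pi\<^sub>M A (\<lambda>_. mark_space))"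
      using y by (simp add: space_PiM)
    have yS [measurable]: "(\<lambda>x. indicator S (y, x) :: ennreal) \<in> borel_measurable borel"
      by (rule measurable_compose[OF measurable_Pair1'[OF y'] borel_measurable_indicator[OF S]])
    have "(\<integral>\<^sup>+u. ennreal (potential_degree_prob P i m) * (\<integral>\<^sup>+x. ennreal (erlang_density m 1 x) *
        (indicator S (restrict (merge A C (y, u)) A, x) *
          (\<Prod>j=1..m. ennreal (h j x (w (merge A C (y, u)) j)))) \<partial>lborel) \<partial>Pi\<^sub>M C mark_distr) =
      (\<integral>\<^sup>+u. ennreal (potential_degree_prob P i m) * (\<integral>\<^sup>+x. ennreal (erlang_density m 1 x) *
        (indicator S (y, x) * (\<Prod>j=1..m. ennreal (h j x (w u j)))) \<partial>lborel) \<partial>Pi\<^sub>M C mark_distr)"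
      by (simp add: restr w_merge cong: prod.cong_simp)
    also have "\<dots> = ennreal (potential_degree_prob P i m) * (\<integral>\<^sup>+u. (\<integral>\<^sup>+x. ennreal (erlang_density m 1 x) *
        (indicator S (y, x) * (\<Prod>j=1..m. ennreal (h j x (w u j)))) \<partial>lborel) \<partial>Pi\<^sub>M C mark_distr)"
      by (rule nn_integral_cmult) measurable
    \<comment> \<open>For fixed \<open>x\<close> the factors involve different children, so
      integration over the product measure turns into a product of integrals; hence \<open>x\<close>
      has to become the outer variable.\<close>
    also have "(\<integral>\<^sup>+u. (\<integral>\<^sup>+x. ennreal (erlang_density m 1 x) *
        (indicator S (y, x) * (\<Prod>j=1..m. ennreal (h j x (w u j)))) \<partial>lborel) \<partial>Pi\<^sub>M C mark_distr) =
      (\<integral>\<^sup>+x. (\<integral>\<^sup>+u. ennreal (erlang_density m 1 x) *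
        (indicator S (y, x) * (\<Prod>j=1..m. ennreal (h j x (w u j)))) \<partial>Pi\<^sub>M C mark_distr) \<partial>lborel)"
      by (rule xC.Fubini') measurable
    also have "\<dots> = (\<integral>\<^sup>+x. ennreal (erlang_density m 1 x) *
      (indicator S (y, x) * ennreal (keep_prob P x ^ card J * (1 - keep_prob P x) ^ (m - card J))) \<partial>lborel)"
    proof (intro nn_integral_cong_AE)
      have "(\<integral>\<^sup>+u. ennreal (erlang_density m 1 x) *
          (indicator S (y, x) * (\<Prod>j=1..m. ennreal (h j x (w u j)))) \<partial>Pi\<^sub>M C mark_distr) =
        ennreal (erlang_density m 1 x) * (indicator S (y, x) *
          ennreal (keep_prob P x ^ card J * (1 - keep_prob P x) ^ (m - card J)))" if "x \<noteq> 0" for x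
      proof (cases "0 < x")
        case True
        let ?q = "keep_prob P x"
        have [measurable]: "(\<lambda>u. \<Prod>j=1..m. ennreal (h j x (w u j))) \<in> borel_measurable (Pi\<^sub>M C mark_distr)"
          by measurable
        \<comment> \<open>A child \<open>c = i @ [j]\<close> remembers its number as
          \<open>last c\<close>, which turns the product over \<open>j\<close> into one over the
          coordinates of the product measure.\<close>
        have "(\<integral>\<^sup>+u. (\<Prod>j=1..m. ennreal (h j x (w u j))) \<partial>Pi\<^sub>M C mark_distr) =
          (\<integral>\<^sup>+u. (\<Prod>c\<in>C. ennreal (h (last c) x (fst (snd (u c))))) \<partial>Pi\<^sub>M C mark_distr)"
          unfolding C_def by (subst prod.reindex) (auto simp: inj_on_def w_def)
        also have "\<dots> = (\<Prod>c\<in>C. \<integral>\<^sup>+k. ennreal (h (last c) x (fst (snd k))) \<partial>mark_distr c)"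
          using C(1) by (intro L.product_nn_integral_prod) measurable
        also have "\<dots> = (\<Prod>c\<in>C. ennreal (if last c \<in> J then ?q else 1 - ?q))"
        proof (intro prod.cong refl)
          fix c assume "c \<in> C"
          then have "c \<in> words" "c \<noteq> []" using C(2,5) by auto
          then show "(\<integral>\<^sup>+k. ennreal (h (last c) x (fst (snd k))) \<partial>mark_distr c) =
              ennreal (if last c \<in> J then ?q else 1 - ?q)"
            using nn_integral_uniform_cdf[OF P _ _ True] nn_integral_one_minus_uniform_cdf[OF P _ _ True]
            by (simp add: h_def)
        qed
        also have "\<dots> = (\<Prod>j=1..m. ennreal (if j \<in> J then ?q else 1 - ?q))"
          unfolding C_def by (subst prod.reindex) (auto simp: inj_on_def)
        also have "\<dots> = ennreal (\<Prod>j=1..m. if j \<in> J then ?q else 1 - ?q)"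
          using P keep_prob_le_1[OF P] by (intro prod_ennreal) auto
        also have "(\<Prod>j=1..m. if j \<in> J then ?q else 1 - ?q) = ?q ^ card J * (1 - ?q) ^ (m - card J)"
        proof -
          have "{1..m} \<inter> J = J" "card ({1..m} \<inter> - J) = m - card J"
            using J by (auto simp: Diff_eq[symmetric] card_Diff_subset finite_subset)
          then show ?thesis
            by (subst prod.If_cases) (simp_all add: Collect_mem_eq)
        qed
        finally show ?thesis
          by (simp add: nn_integral_cmult)
      qed (use that in \<open>simp add: erlang_density_neg\<close>)
      then show "AE x in lborel. (\<integral>\<^sup>+u. ennreal (erlang_density m 1 x) *
          (indicator S (y, x) * (\<Prod>j=1..m. ennreal (h j x (w u j)))) \<partial>Pi\<^sub>M C mark_distr) =
        ennreal (erlang_density m 1 x) * (indicator S (y, x) *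
          ennreal (keep_prob P x ^ card J * (1 - keep_prob P x) ^ (m - card J)))"
        using AE_lborel_singleton[of 0] by (auto elim!: eventually_mono)
    qed
    finally show "(\<integral>\<^sup>+u. ennreal (potential_degree_prob P i m) * (\<integral>\<^sup>+x. ennreal (erlang_density m 1 x) *
        (indicator S (restrict (merge A C (y, u)) A, x) *
          (\<Prod>j=1..m. ennreal (h j x (w (merge A C (y, u)) j)))) \<partial>lborel) \<partial>Pi\<^sub>M C mark_distr) =
      ennreal (potential_degree_prob P i m) * (\<integral>\<^sup>+x. ennreal (erlang_density m 1 x) *
      (indicator S (y, x) * ennreal (keep_prob P x ^ card J * (1 - keep_prob P x) ^ (m - card J))) \<partial>lborel)" .
  qed
  finally show ?thesis .
qed

section \<open>Measurability of the number of children\<close>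

lemma kept_pattern_measurable:
  fixes m :: nat
  assumes i: "i \<in> words"
  shows "Measurable.pred M (\<lambda>\<omega>. n \<omega> i = m \<and> Q {j \<in> {1..m}. \<zeta> \<omega> (i @ [j]) < v \<omega> (i @ [j])})"
proof -
  note [measurable] = degree_measurable[OF i]
  \<comment> \<open>Costs are accessible as measurable components of the mark, and these agree with
    \<open>\<zeta>\<close> at positions 1 to \<open>m\<close> when the degree is \<open>m\<close>.
    An arbitrary \<open>Q\<close> is then a finite disjunction over subsets of
    \<open>{1..m}\<close>.\<close>
  have "(\<lambda>\<omega>. n \<omega> i = m \<and> Q {j \<in> {1..m}. \<zeta> \<omega> (i @ [j]) < v \<omega> (i @ [j])}) =
    (\<lambda>\<omega>. n \<omega> i = m \<and> (\<exists>J\<in>{J \<in> Pow {1..m}. Q J}.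
      \<forall>j\<in>{1..m}. snd (snd (mark_at i \<omega>)) j < v \<omega> (i @ [j]) \<longleftrightarrow> j \<in> J))"
  proof (intro ext conj_cong refl)
    fix \<omega> assume m: "n \<omega> i = m"
    have "{j \<in> {1..m}. \<zeta> \<omega> (i @ [j]) < v \<omega> (i @ [j])} = J \<longleftrightarrow>
        (\<forall>j\<in>{1..m}. snd (snd (mark_at i \<omega>)) j < v \<omega> (i @ [j]) \<longleftrightarrow> j \<in> J)" if "J \<in> Pow {1..m}" for J
      using that m by (auto simp: snd_snd_mark_at i)
    then have "(\<exists>J\<in>{J \<in> Pow {1..m}. Q J}. {j \<in> {1..m}. \<zeta> \<omega> (i @ [j]) < v \<omega> (i @ [j])} = J) \<longleftrightarrow>
        (\<exists>J\<in>{J \<in> Pow {1..m}. Q J}.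
          \<forall>j\<in>{1..m}. snd (snd (mark_at i \<omega>)) j < v \<omega> (i @ [j]) \<longleftrightarrow> j \<in> J)"
      by (intro bex_cong refl) simp
    moreover have "Q {j \<in> {1..m}. \<zeta> \<omega> (i @ [j]) < v \<omega> (i @ [j])} \<longleftrightarrow>
        (\<exists>J\<in>{J \<in> Pow {1..m}. Q J}. {j \<in> {1..m}. \<zeta> \<omega> (i @ [j]) < v \<omega> (i @ [j])} = J)"
      by auto
    ultimately show "Q {j \<in> {1..m}. \<zeta> \<omega> (i @ [j]) < v \<omega> (i @ [j])} \<longleftrightarrow>
        (\<exists>J\<in>{J \<in> Pow {1..m}. Q J}.
          \<forall>j\<in>{1..m}. snd (snd (mark_at i \<omega>)) j < v \<omega> (i @ [j]) \<longleftrightarrow> j \<in> J)"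
      by (rule trans[rotated])
  qed
  also have "Measurable.pred M \<dots>"
  proof -
    have "Measurable.pred M (\<lambda>\<omega>. snd (snd (mark_at i \<omega>)) j < v \<omega> (i @ [j]) \<longleftrightarrow> j \<in> J)"
      if "j \<in> {1..m}" for j J
    proof -
      have [measurable]: "(\<lambda>\<omega>. v \<omega> (i @ [j])) \<in> borel_measurable M"
        using i that by (intro parameter_measurable) simp
      have [measurable]: "(\<lambda>\<omega>. snd (snd (mark_at i \<omega>)) j) \<in> borel_measurable M"
        by (rule measurable_compose[OF mark_at_measurable snd_snd_mark_measurable])
      show ?thesis by measurable
    qed
    then have [measurable]: "Measurable.pred M (\<lambda>\<omega>. \<exists>J\<in>{J \<in> Pow {1..m}. Q J}.
        \<forall>j\<in>{1..m}. snd (snd (mark_at i \<omega>)) j < v \<omega> (i @ [j]) \<longleftrightarrow> j \<in> J)"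
      by (intro pred_intros_finite(3,4)) auto
    show ?thesis by measurable
  qed
  finally show ?thesis .
qed

lemma num_children_measurable [measurable]:
  assumes "i \<in> words"
  shows "(\<lambda>\<omega>. num_children (n \<omega>) (v \<omega>) (\<zeta> \<omega>) i) \<in> measurable M (count_space UNIV)"
proof (rule measurable_count_space_eq2_countable[THEN iffD2], safe)
  fix d
  have "Measurable.pred M (\<lambda>\<omega>. \<exists>m. n \<omega> i = m \<and>
      card {j \<in> {1..m}. \<zeta> \<omega> (i @ [j]) < v \<omega> (i @ [j])} = d)"
    using kept_pattern_measurable[OF assms, where Q = "\<lambda>K. card K = d"]
    by (intro pred_intros_countable) auto
  also have "(\<lambda>\<omega>. \<exists>m. n \<omega> i = m \<and> card {j \<in> {1..m}. \<zeta> \<omega> (i @ [j]) < v \<omega> (i @ [j])} = d) =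
      (\<lambda>\<omega>. num_children (n \<omega>) (v \<omega>) (\<zeta> \<omega>) i = d)"
    by (simp add: num_children_eq)
  finally show "(\<lambda>\<omega>. num_children (n \<omega>) (v \<omega>) (\<zeta> \<omega>) i) -` {d} \<inter> space M \<in> sets M"
    by (simp add: pred_def vimage_def Int_def conj_commute)
qed auto

text \<open>The right-hand side has the shape of the one in \<open>emeasure_kept_pattern\<close>, so
  that pattern probabilities can be read back as expectations of functions of the ancestors and of
  \<open>v i\<close>.\<close>

lemma nn_integral_type_indep:
  assumes i: "i \<in> words" and A: "finite A" "A \<subseteq> words" "i \<notin> A"
    and f [measurable]: "f \<in> borel_measurable (Pi\<^sub>M A (\<lambda>_. mark_space) \<Otimes>\<^sub>M borel)"
  shows "(\<integral>\<^sup>+\<omega>. f (\<lambda>a\<in>A. mark_at a \<omega>, v \<omega> i) * indicator {\<omega>. n \<omega> i = m} \<omega> \<partial>M) =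
    (\<integral>\<^sup>+y. ennreal (potential_degree_prob P i m) * (\<integral>\<^sup>+x. ennreal (erlang_density m 1 x) * f (y, x) \<partial>lborel)
      \<partial>Pi\<^sub>M A mark_distr)"
proof -
  interpret L: product_sigma_finite mark_distr
    unfolding product_sigma_finite_def
    by (intro allI prob_space_imp_sigma_finite prob_space_mark_distr)
  have sets_PiM_L: "sets (Pi\<^sub>M F mark_distr) = sets (Pi\<^sub>M F (\<lambda>_. mark_space))" for F
    by (intro sets_PiM_cong) auto
  let ?X = "\<lambda>\<omega>. \<lambda>a\<in>insert i A. mark_at a \<omega>"
  define g where "g z = f (restrict z A, fst (snd (z i))) * indicator {z. fst (z i) = m} z"
    for z :: "nat list \<Rightarrow> nat \<times> real \<times> (nat \<Rightarrow> real)"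
  have g [measurable]: "g \<in> borel_measurable (Pi\<^sub>M (insert i A) (\<lambda>_. mark_space))"
  proof -
    have [measurable]: "(\<lambda>z. z i) \<in> measurable (Pi\<^sub>M (insert i A) (\<lambda>_. mark_space)) mark_space"
      by measurable
    have [measurable]: "(\<lambda>z. restrict z A) \<in>
        measurable (Pi\<^sub>M (insert i A) (\<lambda>_. mark_space)) (Pi\<^sub>M A (\<lambda>_. mark_space))"
      by (rule measurable_restrict_subset) auto
    show ?thesis
      unfolding g_def by measurable
  qed
  have g' [measurable]: "g \<in> borel_measurable (Pi\<^sub>M (insert i A) mark_distr)"
    using g by (simp cong: measurable_cong_sets add: sets_PiM_L)
  have X [measurable]: "?X \<in> measurable M (Pi\<^sub>M (insert i A) (\<lambda>_. mark_space))"
    by (intro measurable_restrict) measurable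
  have "f (\<lambda>a\<in>A. mark_at a \<omega>, v \<omega> i) * indicator {\<omega>. n \<omega> i = m} \<omega> = g (?X \<omega>)" for \<omega>
  proof -
    have "restrict (?X \<omega>) A = (\<lambda>a\<in>A. mark_at a \<omega>)"
      by (auto simp: restrict_def fun_eq_iff)
    then show ?thesis
      by (simp add: g_def fst_mark_at fst_snd_mark_at i indicator_def)
  qed
  then have "(\<integral>\<^sup>+\<omega>. f (\<lambda>a\<in>A. mark_at a \<omega>, v \<omega> i) * indicator {\<omega>. n \<omega> i = m} \<omega> \<partial>M) =
      (\<integral>\<^sup>+\<omega>. g (?X \<omega>) \<partial>M)"
    by simp
  also have "\<dots> = (\<integral>\<^sup>+z. g z \<partial>Pi\<^sub>M (insert i A) mark_distr)"
    using i A by (subst distr_marks[symmetric]) (auto simp: nn_integral_distr)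
  also have "\<dots> = (\<integral>\<^sup>+y. (\<integral>\<^sup>+k. g (y(i := k)) \<partial>mark_distr i) \<partial>Pi\<^sub>M A mark_distr)"
    using A by (intro L.product_nn_integral_insert) auto
  also have "\<dots> = (\<integral>\<^sup>+y. ennreal (potential_degree_prob P i m) *
      (\<integral>\<^sup>+x. ennreal (erlang_density m 1 x) * f (y, x) \<partial>lborel) \<partial>Pi\<^sub>M A mark_distr)"
  proof (rule nn_integral_cong)
    fix y assume y: "y \<in> space (Pi\<^sub>M A mark_distr)"
    then have y': "y \<in> space (Pi\<^sub>M A (\<lambda>_. mark_space))"
      by (simp add: space_PiM)
    have fy [measurable]: "(\<lambda>x. f (y, x)) \<in> borel_measurable borel"
      by (rule measurable_compose[OF measurable_Pair1'[OF y'] f])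
    have "restrict (y(i := k)) A = y" for k
      using y A(3) by (auto simp: restrict_def fun_eq_iff space_PiM PiE_def extensional_def)
    then have "(\<integral>\<^sup>+k. g (y(i := k)) \<partial>mark_distr i) =
        (\<integral>\<^sup>+k. f (y, fst (snd k)) * indicator {k. fst k = m} k \<partial>mark_distr i)"
      by (simp add: g_def indicator_def)
    also have "\<dots> = (\<integral>\<^sup>+\<omega>. f (y, v \<omega> i) * indicator {\<omega>. n \<omega> i = m} \<omega> \<partial>M)"
      by (simp add: mark_distr_def nn_integral_distr fst_mark_at fst_snd_mark_at i indicator_def)
    finally show "(\<integral>\<^sup>+k. g (y(i := k)) \<partial>mark_distr i) = ennreal (potential_degree_prob P i m) *
        (\<integral>\<^sup>+x. ennreal (erlang_density m 1 x) * f (y, x) \<partial>lborel)"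
      by (simp add: nn_integral_type_eq[OF i fy])
  qed
  finally show ?thesis .
qed

lemma nn_integral_num_children_given_degree:
  assumes P: "set_pmf P \<subseteq> {1..}" and i: "i \<in> words"
    and A: "finite A" "A \<subseteq> words" "i \<notin> A" "\<And>j. i @ [j] \<notin> A"
    and S [measurable]: "S \<in> sets (Pi\<^sub>M A (\<lambda>_. mark_space) \<Otimes>\<^sub>M borel)"
  shows "(\<integral>\<^sup>+\<omega>. of_bool ((\<lambda>a\<in>A. mark_at a \<omega>, v \<omega> i) \<in> S \<and> n \<omega> i = m \<and>
      num_children (n \<omega>) (v \<omega>) (\<zeta> \<omega>) i = d) \<partial>M) =
    (\<integral>\<^sup>+\<omega>. indicator S (\<lambda>a\<in>A. mark_at a \<omega>, v \<omega> i) * ennreal (Bi d m (keep_prob P (v \<omega> i))) *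
      indicator {\<omega>. n \<omega> i = m} \<omega> \<partial>M)"
proof -
  note [measurable] = keep_prob_measurable[OF P] parameter_measurable[OF i]
  let ?S = "\<lambda>\<omega>. (\<lambda>a\<in>A. mark_at a \<omega>, v \<omega> i) \<in> S"
  let ?K = "\<lambda>\<omega>. {j \<in> {1..m}. \<zeta> \<omega> (i @ [j]) < v \<omega> (i @ [j])}"
  let ?Js = "{J. J \<subseteq> {1..m} \<and> card J = d}"
  let ?q = "keep_prob P"
  have fin: "finite ?Js"
    by (rule finite_subset[of _ "Pow {1..m}"]) auto
  have S_pred: "Measurable.pred M ?S"
  proof -
    have "(\<lambda>\<omega>. \<lambda>a\<in>A. mark_at a \<omega>) \<in> measurable M (Pi\<^sub>M A (\<lambda>_. mark_space))"
      by (intro measurable_restrict) measurable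
    then have "(\<lambda>\<omega>. (\<lambda>a\<in>A. mark_at a \<omega>, v \<omega> i)) \<in> measurable M (Pi\<^sub>M A (\<lambda>_. mark_space) \<Otimes>\<^sub>M borel)"
      using parameter_measurable[OF i] by (rule measurable_Pair)
    from measurable_sets[OF this S] show ?thesis
      by (simp add: pred_def vimage_def Int_def conj_commute)
  qed
  have K_pred: "Measurable.pred M (\<lambda>\<omega>. ?S \<omega> \<and> n \<omega> i = m \<and> ?K \<omega> = J)" for J
    using S_pred kept_pattern_measurable[OF i, where Q = "\<lambda>K. K = J"]
    by (rule pred_intros_logic)
  have "(\<integral>\<^sup>+\<omega>. of_bool (?S \<omega> \<and> n \<omega> i = m \<and> num_children (n \<omega>) (v \<omega>) (\<zeta> \<omega>) i = d) \<partial>M) =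
      (\<integral>\<^sup>+\<omega>. (\<Sum>J\<in>?Js. of_bool (?S \<omega> \<and> n \<omega> i = m \<and> ?K \<omega> = J)) \<partial>M)"
  proof (rule nn_integral_cong)
    fix \<omega>
    have "(of_bool (?S \<omega> \<and> n \<omega> i = m \<and> num_children (n \<omega>) (v \<omega>) (\<zeta> \<omega>) i = d) :: ennreal) =
        of_bool (?S \<omega> \<and> n \<omega> i = m) * of_bool (card (?K \<omega>) = d)"
      by (auto simp: num_children_eq)
    also have "\<dots> = (\<Sum>J\<in>?Js. of_bool (?S \<omega> \<and> n \<omega> i = m \<and> ?K \<omega> = J))"
      unfolding sum_subsets_indicator[symmetric] sum_distrib_left
      by (intro sum.cong) auto
    finally show "of_bool (?S \<omega> \<and> n \<omega> i = m \<and> num_children (n \<omega>) (v \<omega>) (\<zeta> \<omega>) i = d) =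
        (\<Sum>J\<in>?Js. of_bool (?S \<omega> \<and> n \<omega> i = m \<and> ?K \<omega> = J) :: ennreal)" .
  qed
  also have "\<dots> = (\<Sum>J\<in>?Js. \<integral>\<^sup>+\<omega>. of_bool (?S \<omega> \<and> n \<omega> i = m \<and> ?K \<omega> = J) \<partial>M)"
    by (intro nn_integral_sum borel_measurable_of_bool K_pred)
  also have "\<dots> = (\<Sum>J\<in>?Js. \<integral>\<^sup>+y. ennreal (potential_degree_prob P i m) *
      (\<integral>\<^sup>+x. ennreal (erlang_density m 1 x) *
        (indicator S (y, x) * ennreal (?q x ^ d * (1 - ?q x) ^ (m - d))) \<partial>lborel) \<partial>Pi\<^sub>M A mark_distr)"
  proof (rule sum.cong)
    fix J assume J: "J \<in> ?Js"
    have "(\<integral>\<^sup>+\<omega>. of_bool (?S \<omega> \<and> n \<omega> i = m \<and> ?K \<omega> = J) \<partial>M) =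
        emeasure M {\<omega> \<in> space M. ?S \<omega> \<and> n \<omega> i = m \<and> ?K \<omega> = J}"
      using K_pred[of J] by (intro emeasure_Collect_eq_nn_integral[symmetric]) (simp add: pred_def)
    then show "(\<integral>\<^sup>+\<omega>. of_bool (?S \<omega> \<and> n \<omega> i = m \<and> ?K \<omega> = J) \<partial>M) =
        (\<integral>\<^sup>+y. ennreal (potential_degree_prob P i m) *
      (\<integral>\<^sup>+x. ennreal (erlang_density m 1 x) *
        (indicator S (y, x) * ennreal (?q x ^ d * (1 - ?q x) ^ (m - d))) \<partial>lborel) \<partial>Pi\<^sub>M A mark_distr)"
      using emeasure_kept_pattern[OF P i A _ S, of J m] J by simp
  qed simp
  also have "\<dots> = (\<Sum>J\<in>?Js. \<integral>\<^sup>+\<omega>. indicator S (\<lambda>a\<in>A. mark_at a \<omega>, v \<omega> i) *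
      ennreal (?q (v \<omega> i) ^ d * (1 - ?q (v \<omega> i)) ^ (m - d)) * indicator {\<omega>. n \<omega> i = m} \<omega> \<partial>M)"
    by (subst nn_integral_type_indep[OF i A(1-3),
          where f = "\<lambda>(y, x). indicator S (y, x) * ennreal (?q x ^ d * (1 - ?q x) ^ (m - d))", simplified])
      simp_all
  \<comment> \<open>Only \<open>card J = d\<close> entered the summand, so the same value is counted
    once for each of the \<open>m choose d\<close> patterns.\<close>
  also have "\<dots> = of_nat (m choose d) * (\<integral>\<^sup>+\<omega>. indicator S (\<lambda>a\<in>A. mark_at a \<omega>, v \<omega> i) *
      ennreal (?q (v \<omega> i) ^ d * (1 - ?q (v \<omega> i)) ^ (m - d)) * indicator {\<omega>. n \<omega> i = m} \<omega> \<partial>M)"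
    using n_subsets[of "{1..m}" d] by simp
  also have "\<dots> = (\<integral>\<^sup>+\<omega>. indicator S (\<lambda>a\<in>A. mark_at a \<omega>, v \<omega> i) *
      ennreal (Bi d m (?q (v \<omega> i))) * indicator {\<omega>. n \<omega> i = m} \<omega> \<partial>M)"
  proof -
    note [measurable] = S_pred degree_measurable[OF i]
    have [measurable]: "(\<lambda>\<omega>. indicator S (\<lambda>a\<in>A. mark_at a \<omega>, v \<omega> i) :: ennreal) \<in> borel_measurable M"
      using S_pred unfolding indicator_def of_bool_def by measurable
    show ?thesis
      by (subst nn_integral_cmult[symmetric])
        (auto simp: Bi_def ennreal_mult' ennreal_of_nat_eq_real_of_nat mult_ac intro!: nn_integral_cong)
  qed
  finally show ?thesis .
qed

lemma ancestors_measurable: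
  assumes "i \<in> words"
  shows "(\<lambda>\<omega>. (\<lambda>a\<in>A. mark_at a \<omega>, v \<omega> i)) \<in> measurable M (Pi\<^sub>M A (\<lambda>_. mark_space) \<Otimes>\<^sub>M borel)"
  using parameter_measurable[OF assms]
  by (intro measurable_Pair measurable_restrict mark_at_measurable)

lemma type_measurable:
  assumes "i \<in> words"
  shows "(\<lambda>\<omega>. (n \<omega> i, v \<omega> i)) \<in> measurable M (count_space UNIV \<Otimes>\<^sub>M borel)"
  using parameter_measurable[OF assms] degree_measurable[OF assms] by (intro measurable_Pair)

lemma Bi_type_measurable:
  assumes "set_pmf P \<subseteq> {1..}"
  shows "(\<lambda>(m, x). Bi d m (keep_prob P x)) \<in> borel_measurable (count_space UNIV \<Otimes>\<^sub>M borel)"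
proof -
  note [measurable] = keep_prob_measurable[OF assms]
  show ?thesis
    unfolding case_prod_beta by measurable
qed

section \<open>The conditional law of the number of children\<close>

text \<open>As \<open>T\<close> runs through the measurable sets of types, this is the averaging
  identity behind conditional probabilities given the type; \<open>S\<close> is kept for the event
  on which the measure is conditioned.\<close>

lemma emeasure_num_children:
  assumes P: "set_pmf P \<subseteq> {1..}" and i: "i \<in> words"
    and A: "finite A" "A \<subseteq> words" "i \<notin> A" "\<And>j. i @ [j] \<notin> A"
    and S: "S \<in> sets (Pi\<^sub>M A (\<lambda>_. mark_space) \<Otimes>\<^sub>M borel)"
    and T: "T \<in> sets (count_space UNIV \<Otimes>\<^sub>M borel)"
  shows "emeasure M {\<omega> \<in> space M. (\<lambda>a\<in>A. mark_at a \<omega>, v \<omega> i) \<in> S \<and> (n \<omega> i, v \<omega> i) \<in> T \<and>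
      num_children (n \<omega>) (v \<omega>) (\<zeta> \<omega>) i = d} =
    (\<integral>\<^sup>+\<omega>. of_bool ((\<lambda>a\<in>A. mark_at a \<omega>, v \<omega> i) \<in> S \<and> (n \<omega> i, v \<omega> i) \<in> T) *
      ennreal (Bi d (n \<omega> i) (keep_prob P (v \<omega> i))) \<partial>M)"
proof -
  let ?S = "\<lambda>\<omega>. (\<lambda>a\<in>A. mark_at a \<omega>, v \<omega> i) \<in> S"
  let ?T = "\<lambda>\<omega>. (n \<omega> i, v \<omega> i) \<in> T"
  let ?D = "\<lambda>\<omega>. num_children (n \<omega>) (v \<omega>) (\<zeta> \<omega>) i = d"
  let ?B = "\<lambda>\<omega>. ennreal (Bi d (n \<omega> i) (keep_prob P (v \<omega> i)))"
  \<comment> \<open>Once the degree is fixed to \<open>m\<close>, the condition on the type concerns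
    \<open>v i\<close> alone and is absorbed into \<open>S\<close>, whose second coordinate is
    \<open>v i\<close>.\<close>
  define S' where "S' m = {z \<in> S. (m, snd z) \<in> T}" for m
  have S': "S' m \<in> sets (Pi\<^sub>M A (\<lambda>_. mark_space) \<Otimes>\<^sub>M borel)" for m
  proof -
    have "(\<lambda>z. (m, snd z)) \<in> measurable (Pi\<^sub>M A (\<lambda>_. mark_space) \<Otimes>\<^sub>M borel) (count_space UNIV \<Otimes>\<^sub>M borel)"
      by measurable
    from measurable_sets[OF this T] S
    have "S \<inter> ((\<lambda>z. (m, snd z)) -` T \<inter> space (Pi\<^sub>M A (\<lambda>_. mark_space) \<Otimes>\<^sub>M borel)) \<in>
        sets (Pi\<^sub>M A (\<lambda>_. mark_space) \<Otimes>\<^sub>M borel)"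
      by blast
    also have "S \<inter> ((\<lambda>z. (m, snd z)) -` T \<inter> space (Pi\<^sub>M A (\<lambda>_. mark_space) \<Otimes>\<^sub>M borel)) = S' m"
      using sets.sets_into_space[OF S] by (auto simp: S'_def)
    finally show ?thesis .
  qed
  have S_pred [measurable]: "Measurable.pred M ?S"
    using measurable_sets[OF ancestors_measurable[OF i] S]
    by (simp add: pred_def vimage_def Int_def conj_commute)
  have T_pred [measurable]: "Measurable.pred M ?T"
    using measurable_sets[OF type_measurable[OF i] T]
    by (simp add: pred_def vimage_def Int_def conj_commute)
  have D_pred [measurable]: "Measurable.pred M ?D"
    using measurable_compose[OF num_children_measurable[OF i], of "\<lambda>k. k = d" "count_space UNIV"] by simp
  have B [measurable]: "?B \<in> borel_measurable M"
    using measurable_compose[OF type_measurable[OF i] Bi_type_measurable[OF P]] by simp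
  have STD: "Measurable.pred M (\<lambda>\<omega>. ?S \<omega> \<and> ?T \<omega> \<and> ?D \<omega>)" "Measurable.pred M (\<lambda>\<omega>. ?S \<omega> \<and> ?T \<omega>)"
    by (intro pred_intros_logic S_pred T_pred D_pred)+
  have "emeasure M {\<omega> \<in> space M. ?S \<omega> \<and> ?T \<omega> \<and> ?D \<omega>} = (\<integral>\<^sup>+\<omega>. of_bool (?S \<omega> \<and> ?T \<omega> \<and> ?D \<omega>) \<partial>M)"
    using STD(1) by (intro emeasure_Collect_eq_nn_integral) (simp add: pred_def)
  also have "\<dots> = (\<Sum>m. \<integral>\<^sup>+\<omega>. of_bool (?S \<omega> \<and> ?T \<omega> \<and> ?D \<omega>) * indicator {\<omega>. n \<omega> i = m} \<omega> \<partial>M)"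
    using degree_measurable[OF i] borel_measurable_of_bool[OF STD(1)]
    by (rule nn_integral_split_countable)
  also have "\<dots> = (\<Sum>m. \<integral>\<^sup>+\<omega>. of_bool (?S \<omega> \<and> ?T \<omega>) * ?B \<omega> * indicator {\<omega>. n \<omega> i = m} \<omega> \<partial>M)"
  proof (intro suminf_cong)
    fix m
    have "(\<integral>\<^sup>+\<omega>. of_bool (?S \<omega> \<and> ?T \<omega> \<and> ?D \<omega>) * indicator {\<omega>. n \<omega> i = m} \<omega> \<partial>M) =
      (\<integral>\<^sup>+\<omega>. of_bool ((\<lambda>a\<in>A. mark_at a \<omega>, v \<omega> i) \<in> S' m \<and> n \<omega> i = m \<and> ?D \<omega>) \<partial>M)"
      by (intro nn_integral_cong) (auto simp: S'_def split: split_indicator)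
    also have "\<dots> = (\<integral>\<^sup>+\<omega>. indicator (S' m) (\<lambda>a\<in>A. mark_at a \<omega>, v \<omega> i) *
        ennreal (Bi d m (keep_prob P (v \<omega> i))) * indicator {\<omega>. n \<omega> i = m} \<omega> \<partial>M)"
      by (rule nn_integral_num_children_given_degree[OF P i A S'])
    also have "\<dots> = (\<integral>\<^sup>+\<omega>. of_bool (?S \<omega> \<and> ?T \<omega>) * ?B \<omega> * indicator {\<omega>. n \<omega> i = m} \<omega> \<partial>M)"
      by (intro nn_integral_cong) (auto simp: S'_def split: split_indicator)
    finally show "(\<integral>\<^sup>+\<omega>. of_bool (?S \<omega> \<and> ?T \<omega> \<and> ?D \<omega>) * indicator {\<omega>. n \<omega> i = m} \<omega> \<partial>M) =
      (\<integral>\<^sup>+\<omega>. of_bool (?S \<omega> \<and> ?T \<omega>) * ?B \<omega> * indicator {\<omega>. n \<omega> i = m} \<omega> \<partial>M)" .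
  qed
  also have "\<dots> = (\<integral>\<^sup>+\<omega>. of_bool (?S \<omega> \<and> ?T \<omega>) * ?B \<omega> \<partial>M)"
    using degree_measurable[OF i]
      borel_measurable_times_ennreal[OF borel_measurable_of_bool[OF STD(2)] B]
    by (rule nn_integral_split_countable[symmetric])
  finally show ?thesis .
qed

text \<open>The binomial weight depends on the type alone, so restricting the averaging identity to
  \<open>E\<close> and dividing by the probability of \<open>E\<close> leaves the same version of
  the conditional probability.\<close>

lemma cond_prob_num_children:
  assumes P: "set_pmf P \<subseteq> {1..}" and i: "i \<in> words"
    and A: "finite A" "A \<subseteq> words" "i \<notin> A" "\<And>j. i @ [j] \<notin> A"
    and S: "S \<in> sets (Pi\<^sub>M A (\<lambda>_. mark_space) \<Otimes>\<^sub>M borel)"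
    and E: "E = {\<omega> \<in> space M. (\<lambda>a\<in>A. mark_at a \<omega>, v \<omega> i) \<in> S}"
  shows "has_cond_prob_given_type (uniform_measure M E) n v i
    {\<omega> \<in> space M. num_children (n \<omega>) (v \<omega>) (\<zeta> \<omega>) i = d} (\<lambda>m x. Bi d m (keep_prob P x))"
proof -
  let ?N = "uniform_measure M E"
  let ?F = "type_algebra ?N n v i"
  let ?D = "{\<omega> \<in> space M. num_children (n \<omega>) (v \<omega>) (\<zeta> \<omega>) i = d}"
  let ?g = "\<lambda>\<omega>. Bi d (n \<omega> i) (keep_prob P (v \<omega> i))"
  have E_sets [measurable]: "E \<in> sets M"
    using measurable_sets[OF ancestors_measurable[OF i] S] unfolding E
    by (simp add: vimage_def Int_def conj_commute)
  have D_sets: "?D \<in> sets M"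
    using measurable_sets[OF num_children_measurable[OF i], of "{d}"]
    by (simp add: vimage_def Int_def conj_commute)
  have F_sets: "\<exists>T\<in>sets (count_space UNIV \<Otimes>\<^sub>M borel). B = {\<omega> \<in> space M. (n \<omega> i, v \<omega> i) \<in> T}"
    if "B \<in> sets ?F" for B
  proof -
    have "B \<in> {(\<lambda>\<omega>. (n \<omega> i, v \<omega> i)) -` T \<inter> space M | T. T \<in> sets (count_space UNIV \<Otimes>\<^sub>M borel)}"
      using that unfolding type_algebra_def
      by (subst (asm) sets_vimage_algebra2) (auto simp: space_pair_measure)
    then show ?thesis by auto
  qed
  show ?thesis
  proof (cases "emeasure M E = 0")
    case True
    \<comment> \<open>If \<open>E\<close> is a null set, every property holds almost everywhere for
      \<open>uniform_measure M E\<close>.\<close>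
    then have "AE \<omega> in M. \<omega> \<notin> E"
      using E_sets by (intro AE_I'[of E]) auto
    then show ?thesis
      unfolding has_cond_prob_given_type_def
      by (intro AE_uniform_measureI E_sets) auto
  next
    case False
    then interpret N: prob_space ?N
      by (rule prob_space_uniform_measure) simp
    have sub: "subalgebra ?N ?F"
    proof (unfold subalgebra_def, intro conjI subsetI)
      show "space ?F = space ?N" by (simp add: type_algebra_def)
      fix B assume "B \<in> sets ?F"
      from F_sets[OF this] obtain T where T: "T \<in> sets (count_space UNIV \<Otimes>\<^sub>M borel)"
        and B: "B = {\<omega> \<in> space M. (n \<omega> i, v \<omega> i) \<in> T}"
        by blast
      from measurable_sets[OF type_measurable[OF i] T] show "B \<in> sets ?N"
        unfolding B by (simp add: vimage_def Int_def conj_commute)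
    qed
    have g_F: "?g \<in> borel_measurable ?F"
    proof -
      have "(\<lambda>\<omega>. (n \<omega> i, v \<omega> i)) \<in> measurable ?F (count_space UNIV \<Otimes>\<^sub>M borel)"
        unfolding type_algebra_def
        by (rule measurable_vimage_algebra1) (auto simp: space_pair_measure)
      from measurable_compose[OF this Bi_type_measurable[OF P]] show ?thesis by simp
    qed
    have g_M: "?g \<in> borel_measurable M"
      using measurable_compose[OF type_measurable[OF i] Bi_type_measurable[OF P]] by simp
    show ?thesis
      unfolding has_cond_prob_given_type_def
    proof (rule real_cond_exp_indicator_charact[OF _ sub _ g_F])
      show "finite_measure ?N" by (rule N.finite_measure_axioms)
      show "?D \<in> sets ?N" using D_sets by simp
      show "0 \<le> ?g \<omega>" "?g \<omega> \<le> 1" for \<omega>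
        using P keep_prob_le_1[OF P] by (auto intro: Bi_nonneg Bi_le_1)
      fix B assume B_F: "B \<in> sets ?F"
      then have B_M: "B \<in> sets M"
        using sub by (auto simp: subalgebra_def)
      from F_sets[OF B_F] obtain T where T: "T \<in> sets (count_space UNIV \<Otimes>\<^sub>M borel)"
        and B: "B = {\<omega> \<in> space M. (n \<omega> i, v \<omega> i) \<in> T}"
        by blast
      have "emeasure ?N (?D \<inter> B) = emeasure M (E \<inter> (?D \<inter> B)) / emeasure M E"
        using D_sets B_M by simp
      also have "E \<inter> (?D \<inter> B) = {\<omega> \<in> space M. (\<lambda>a\<in>A. mark_at a \<omega>, v \<omega> i) \<in> S \<and>
          (n \<omega> i, v \<omega> i) \<in> T \<and> num_children (n \<omega>) (v \<omega>) (\<zeta> \<omega>) i = d}"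
        by (auto simp: E B)
      also have "emeasure M \<dots> = (\<integral>\<^sup>+\<omega>. ennreal (?g \<omega>) * indicator B \<omega> * indicator E \<omega> \<partial>M)"
        unfolding emeasure_num_children[OF P i A S T]
        by (intro nn_integral_cong) (auto simp: E B split: split_indicator)
      also have "\<dots> / emeasure M E = (\<integral>\<^sup>+\<omega>\<in>B. ennreal (?g \<omega>) \<partial>?N)"
        using g_M B_M E_sets by (intro nn_integral_uniform_measure[symmetric]) auto
      finally show "emeasure ?N (?D \<inter> B) = (\<integral>\<^sup>+\<omega>\<in>B. ennreal (?g \<omega>) \<partial>?N)" .
    qed
  qed
qed

text \<open>Conditioning on the whole space, with an empty set of ancestors, leaves \<open>M\<close>
  unchanged.\<close>

lemma cond_prob_num_children_uncond:
  assumes P: "set_pmf P \<subseteq> {1..}" and i: "i \<in> words"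
  shows "has_cond_prob_given_type M n v i
    {\<omega> \<in> space M. num_children (n \<omega>) (v \<omega>) (\<zeta> \<omega>) i = d} (\<lambda>m x. Bi d m (keep_prob P x))"
proof -
  have "uniform_measure M (space M) = density M (\<lambda>_. 1)"
    unfolding uniform_measure_def by (intro density_cong) (auto simp: emeasure_space_1)
  then have "uniform_measure M (space M) = M"
    by (simp add: density_1)
  moreover have "space M = {\<omega> \<in> space M. (\<lambda>a\<in>{}. mark_at a \<omega>, v \<omega> i) \<in>
      space (Pi\<^sub>M {} (\<lambda>_. mark_space) \<Otimes>\<^sub>M borel)}"
    using measurable_space[OF ancestors_measurable[OF i, of "{}"]] by auto
  ultimately show ?thesis
    using cond_prob_num_children[OF P i, of "{}" _ "space M" d] by auto
qed

lemma cond_prob_num_children_ewt: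
  assumes P: "set_pmf P \<subseteq> {1..}" and i: "i \<in> words"
  shows "has_cond_prob_given_type
    (uniform_measure M {\<omega> \<in> space M. i \<in> ewt (n \<omega>) (v \<omega>) (\<zeta> \<omega>)}) n v i
    {\<omega> \<in> space M. num_children (n \<omega>) (v \<omega>) (\<zeta> \<omega>) i = d} (\<lambda>m x. Bi d m (keep_prob P x))"
proof -
  \<comment> \<open>The proper prefixes of \<open>i\<close>, i.e. its ancestors. They are shorter
    than \<open>i\<close>, so neither \<open>i\<close> nor any of its potential children is among
    them.\<close>
  define A where "A = (\<lambda>k. take k i) ` {..<length i}"
  \<comment> \<open>The cost of an edge is stored in the mark of its upper end, an ancestor of
    \<open>i\<close>. The lower end is an ancestor too, except on the last edge, where it is
    \<open>i\<close> and its parameter is the second coordinate \<open>x\<close>.\<close>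
  let ?Q = "\<lambda>(y, x) k. i ! k \<le> fst (y (take k i)) \<and>
    snd (snd (y (take k i))) (i ! k) < (if Suc k < length i then fst (snd (y (take (Suc k) i))) else x)"
  define S where "S = {z \<in> space (Pi\<^sub>M A (\<lambda>_. mark_space) \<Otimes>\<^sub>M borel). \<forall>k\<in>{..<length i}. ?Q z k}"
  have A: "finite A" "A \<subseteq> words" "i \<notin> A" "\<And>j. i @ [j] \<notin> A"
  proof -
    have "length a < length i" if "a \<in> A" for a
      using that by (auto simp: A_def)
    then show "i \<notin> A" "\<And>j. i @ [j] \<notin> A"
      by fastforce+
  qed (use i in \<open>auto simp: A_def intro: take_in_words\<close>)
  have take_A: "take k i \<in> A" if "k < length i" for k
    using that by (auto simp: A_def)
  have S: "S \<in> sets (Pi\<^sub>M A (\<lambda>_. mark_space) \<Otimes>\<^sub>M borel)"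
  proof -
    have comp: "(\<lambda>z. fst z (take k i)) \<in> measurable (Pi\<^sub>M A (\<lambda>_. mark_space) \<Otimes>\<^sub>M borel) mark_space"
      if "k < length i" for k
      by (rule measurable_compose[OF measurable_fst measurable_component_singleton[OF take_A[OF that]]])
    have "Measurable.pred (Pi\<^sub>M A (\<lambda>_. mark_space) \<Otimes>\<^sub>M borel) (\<lambda>z. ?Q z k)" if k: "k < length i" for k
    proof -
      note [measurable] = measurable_compose[OF comp[OF k] fst_mark_measurable]
        measurable_compose[OF comp[OF k] snd_snd_mark_measurable]
      have [measurable]: "(\<lambda>z. if Suc k < length i then fst (snd (fst z (take (Suc k) i))) else snd z)
          \<in> borel_measurable (Pi\<^sub>M A (\<lambda>_. mark_space) \<Otimes>\<^sub>M borel)"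
        using measurable_compose[OF comp fst_snd_mark_measurable] by (cases "Suc k < length i") auto
      show ?thesis
        unfolding case_prod_beta by measurable
    qed
    then have "Measurable.pred (Pi\<^sub>M A (\<lambda>_. mark_space) \<Otimes>\<^sub>M borel) (\<lambda>z. \<forall>k\<in>{..<length i}. ?Q z k)"
      by (intro pred_intros_finite(3)) auto
    then show ?thesis
      by (simp add: S_def pred_def)
  qed
  have "i \<in> ewt (n \<omega>) (v \<omega>) (\<zeta> \<omega>) \<longleftrightarrow> (\<lambda>a\<in>A. mark_at a \<omega>, v \<omega> i) \<in> S" if \<omega>: "\<omega> \<in> space M" for \<omega>
  proof -
    have "i ! k \<le> n \<omega> (take k i) \<and> \<zeta> \<omega> (take (Suc k) i) < v \<omega> (take (Suc k) i) \<longleftrightarrow>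
        ?Q (\<lambda>a\<in>A. mark_at a \<omega>, v \<omega> i) k" if k: "k < length i" for k
    proof -
      have w: "take k i \<in> words" "take (Suc k) i \<in> words"
        using i by (auto intro: take_in_words)
      have 1: "1 \<le> i ! k"
        using i k by (auto simp: words_def)
      have v: "(if Suc k < length i then fst (snd ((\<lambda>a\<in>A. mark_at a \<omega>) (take (Suc k) i))) else v \<omega> i) =
          v \<omega> (take (Suc k) i)"
        using k by (auto simp: take_A fst_snd_mark_at w)
      show ?thesis
        unfolding case_prod_conv v
        using k w 1 by (auto simp: take_A fst_mark_at snd_snd_mark_at take_Suc_conv_app_nth)
    qed
    then show ?thesis
      using measurable_space[OF ancestors_measurable[OF i, of A] \<omega>]
      by (auto simp: mem_ewt_iff[OF i] S_def)
  qed
  then have "{\<omega> \<in> space M. i \<in> ewt (n \<omega>) (v \<omega>) (\<zeta> \<omega>)} =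
      {\<omega> \<in> space M. (\<lambda>a\<in>A. mark_at a \<omega>, v \<omega> i) \<in> S}"
    by blast
  from cond_prob_num_children[OF P i A S this] show ?thesis .
qed

end

section \<open>The degree of the root\<close>

lemma nn_integral_erlang_density_1 [simp]: "(\<integral>\<^sup>+x. ennreal (erlang_density m 1 x) \<partial>lborel) = 1"
  using nn_integral_erlang_ith_moment[of 1 m 0] by simp

text \<open>The factor \<open>exp (- x) * x ^ m / fact m\<close> is the density of Erlang(m + 1),
  and a binomial weight lies between 0 and 1; so the product is integrable and the two integrals
  agree.\<close>

lemma ennreal_erlang_Bi_integral:
  assumes P: "set_pmf P \<subseteq> {1..}"
  shows "ennreal (LBINT x:{0..}. exp (- x) * x ^ m / fact m * Bi d m (keep_prob P x)) =
    (\<integral>\<^sup>+x. ennreal (erlang_density m 1 x) * ennreal (Bi d m (keep_prob P x)) \<partial>lborel)"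
proof -
  note [measurable] = keep_prob_measurable[OF P]
  have Bi01: "0 \<le> Bi d m (keep_prob P x)" "Bi d m (keep_prob P x) \<le> 1" for x
    using P keep_prob_le_1[OF P] by (auto intro: Bi_nonneg Bi_le_1)
  have "integrable lborel (erlang_density m 1)"
    by (intro integrableI_nonneg) auto
  then have int: "integrable lborel (\<lambda>x. erlang_density m 1 x * Bi d m (keep_prob P x))"
    by (rule Bochner_Integration.integrable_bound)
      (use Bi01 in \<open>auto simp: abs_mult mult_left_le\<close>)
  have "(LBINT x:{0..}. exp (- x) * x ^ m / fact m * Bi d m (keep_prob P x)) =
      (LBINT x. erlang_density m 1 x * Bi d m (keep_prob P x))"
    unfolding set_lebesgue_integral_def
    by (intro Bochner_Integration.integral_cong) (auto simp: erlang_density_def split: split_indicator)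
  then show ?thesis
    using Bi01 nn_integral_eq_integral[OF int] by (simp add: ennreal_mult)
qed

text \<open>In the mean degree the factor \<open>m\<close> stems from the mean of the binomial law
  and \<open>1 / x\<close> from \<open>keep_prob\<close>; together they lower the shape by
  one.\<close>

lemma erlang_density_times_degree:
  assumes "0 < x" "1 \<le> m"
  shows "erlang_density m 1 x * real m / x = erlang_density (m - 1) 1 x"
proof -
  obtain k where "m = Suc k" using assms by (cases m) auto
  then show ?thesis
    using assms by (simp add: erlang_density_def del: of_nat_Suc)
qed

lemma nn_integral_degree_keep_prob:
  assumes P: "set_pmf P \<subseteq> {1..}" and m: "1 \<le> m"
  shows "(\<integral>\<^sup>+x. ennreal (erlang_density m 1 x) * ennreal (real m * keep_prob P x) \<partial>lborel) =
    (\<integral>\<^sup>+y\<in>{0..}. ennreal (survival P y) * ennreal (erlang_ccdf m y) \<partial>lborel)"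
proof -
  note [measurable] = keep_prob_measurable[OF P]
  let ?e = "\<lambda>x. ennreal (erlang_density (m - 1) 1 x)"
  have "(\<integral>\<^sup>+x. ennreal (erlang_density m 1 x) * ennreal (real m * keep_prob P x) \<partial>lborel) =
      (\<integral>\<^sup>+x. (\<integral>\<^sup>+y. ennreal (survival P y) * (?e x * of_bool (0 \<le> y \<and> y \<le> x)) \<partial>lborel) \<partial>lborel)"
  proof (intro nn_integral_cong_AE)
    have "ennreal (erlang_density m 1 x) * ennreal (real m * keep_prob P x) =
        (\<integral>\<^sup>+y. ennreal (survival P y) * (?e x * of_bool (0 \<le> y \<and> y \<le> x)) \<partial>lborel)" if "x \<noteq> 0" for x
    proof (cases "0 < x")
      case True
      have "ennreal (erlang_density m 1 x) * ennreal (real m * keep_prob P x) =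
          ennreal (erlang_density m 1 x * real m) * ennreal (keep_prob P x)"
        using P by (simp add: ennreal_mult mult.assoc)
      also have "\<dots> = (\<integral>\<^sup>+y. ennreal (erlang_density m 1 x * real m) *
          (ennreal (1 / x * survival P y) * indicator {0..x} y) \<partial>lborel)"
        unfolding ennreal_keep_prob[OF P] by (rule nn_integral_cmult[symmetric]) measurable
      also have "\<dots> = (\<integral>\<^sup>+y. ennreal (survival P y) * (?e x * of_bool (0 \<le> y \<and> y \<le> x)) \<partial>lborel)"
        unfolding erlang_density_times_degree[OF True m, symmetric]
        using True
        by (intro nn_integral_cong)
          (auto simp: ennreal_mult[symmetric] mult_ac split: split_indicator)
      finally show ?thesis .
    qed (use that in \<open>simp add: erlang_density_neg\<close>)
    then show "AE x in lborel. ennreal (erlang_density m 1 x) * ennreal (real m * keep_prob P x) =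
        (\<integral>\<^sup>+y. ennreal (survival P y) * (?e x * of_bool (0 \<le> y \<and> y \<le> x)) \<partial>lborel)"
      using AE_lborel_singleton[of 0] by (auto elim!: eventually_mono)
  qed
  also have "\<dots> = (\<integral>\<^sup>+y. (\<integral>\<^sup>+x. ennreal (survival P y) * (?e x * of_bool (0 \<le> y \<and> y \<le> x)) \<partial>lborel) \<partial>lborel)"
    unfolding of_bool_def by (rule lborel_pair.Fubini') measurable
  also have "\<dots> = (\<integral>\<^sup>+y\<in>{0..}. ennreal (survival P y) * ennreal (erlang_ccdf m y) \<partial>lborel)"
  proof (intro nn_integral_cong)
    fix y :: real
    \<comment> \<open>The weak and the strict inequality between \<open>y\<close> and
      \<open>x\<close> differ only at \<open>x = y\<close>, a null set.\<close>
    have "(\<integral>\<^sup>+x. ennreal (survival P y) * (?e x * of_bool (0 \<le> y \<and> y \<le> x)) \<partial>lborel) =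
        (\<integral>\<^sup>+x. ennreal (survival P y) * indicator {0..} y * (?e x * indicator {y<..} x) \<partial>lborel)"
      using AE_lborel_singleton[of y]
      by (intro nn_integral_cong_AE) (auto elim!: eventually_mono split: split_indicator)
    also have "\<dots> = ennreal (survival P y) * indicator {0..} y * ennreal (erlang_ccdf m y)"
      unfolding ennreal_erlang_ccdf_eq by (rule nn_integral_cmult) measurable
    finally show "(\<integral>\<^sup>+x. ennreal (survival P y) * (?e x * of_bool (0 \<le> y \<and> y \<le> x)) \<partial>lborel) =
        ennreal (survival P y) * ennreal (erlang_ccdf m y) * indicator {0..} y"
      by (simp add: mult_ac)
  qed
  finally show ?thesis .
qed

lemma nn_integral_survival_ccdf:
  "(\<integral>\<^sup>+y\<in>{0..}. ennreal (survival P y) * ennreal (erlang_ccdf m y) \<partial>lborel) =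
    (\<integral>\<^sup>+k. (\<integral>\<^sup>+y\<in>{0..}. ennreal (erlang_ccdf k y * erlang_ccdf m y) \<partial>lborel) \<partial>measure_pmf P)"
proof -
  have "(\<integral>\<^sup>+y\<in>{0..}. ennreal (survival P y) * ennreal (erlang_ccdf m y) \<partial>lborel) =
      (\<integral>\<^sup>+y. (\<Sum>k. ennreal (pmf P k) *
        (ennreal (erlang_ccdf k y * erlang_ccdf m y) * indicator {0..} y)) \<partial>lborel)"
    unfolding ennreal_survival nn_integral_pmf_nat
    by (intro nn_integral_cong) (simp add: ennreal_mult mult.assoc ennreal_suminf_multc[symmetric])
  also have "\<dots> = (\<Sum>k. \<integral>\<^sup>+y. ennreal (pmf P k) *
        (ennreal (erlang_ccdf k y * erlang_ccdf m y) * indicator {0..} y) \<partial>lborel)"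
    by (rule nn_integral_suminf) measurable
  also have "\<dots> = (\<Sum>k. ennreal (pmf P k) *
        (\<integral>\<^sup>+y\<in>{0..}. ennreal (erlang_ccdf k y * erlang_ccdf m y) \<partial>lborel))"
    by (intro suminf_cong nn_integral_cmult) measurable
  finally show ?thesis
    by (simp add: nn_integral_pmf_nat)
qed

text \<open>Finiteness comes from the explicit value in \<open>nn_integral_erlang_ccdf_mult\<close>;
  it makes the real integral a genuine one.\<close>

lemma ennreal_ccdf_integral:
  assumes "1 \<le> k" "1 \<le> m"
  shows "ennreal (LBINT y:{0..}. erlang_ccdf k y * erlang_ccdf m y) =
    (\<integral>\<^sup>+y\<in>{0..}. ennreal (erlang_ccdf k y * erlang_ccdf m y) \<partial>lborel)"
proof -
  have eq: "ennreal (indicat_real {0..} y *\<^sub>R (erlang_ccdf k y * erlang_ccdf m y)) =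
      ennreal (erlang_ccdf k y * erlang_ccdf m y) * indicator {0..} y" for y
    by (simp split: split_indicator)
  have "integrable lborel (\<lambda>y. indicat_real {0..} y *\<^sub>R (erlang_ccdf k y * erlang_ccdf m y))"
    using nn_integral_erlang_ccdf_mult[OF assms]
    by (intro integrableI_nonneg) (auto simp: eq[unfolded real_scaleR_def])
  from nn_integral_eq_integral[OF this] show ?thesis
    unfolding set_lebesgue_integral_def eq by simp
qed

lemma ccdf_integral_nonneg: "0 \<le> (LBINT y:{0..}. erlang_ccdf k y * erlang_ccdf m y)"
  unfolding set_lebesgue_integral_def by (intro Bochner_Integration.integral_nonneg) simp

lemma ccdf_integral_eq_sum:
  assumes "1 \<le> k" "1 \<le> m"
  shows "(LBINT y:{0..}. erlang_ccdf k y * erlang_ccdf m y) =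
    (\<Sum>a=0..k-1. \<Sum>l=0..m-1. real ((a + l) choose a) * (1 / 2) ^ (a + l + 1))"
proof -
  have "ennreal (LBINT y:{0..}. erlang_ccdf k y * erlang_ccdf m y) =
      ennreal (\<Sum>a=0..k-1. \<Sum>l=0..m-1. real ((a + l) choose a) * (1 / 2) ^ (a + l + 1))"
    unfolding ennreal_ccdf_integral[OF assms] by (rule nn_integral_erlang_ccdf_mult[OF assms])
  then show ?thesis
    by (subst (asm) ennreal_inj) (auto intro!: sum_nonneg ccdf_integral_nonneg)
qed

text \<open>One tail is at most 1 and the other integrates to its mean \<open>m\<close>. The bound
  is uniform in \<open>k\<close>, so it survives averaging over \<open>k\<close>, and the finite
  mean of \<open>P\<close> then controls the sum over \<open>m\<close>.\<close>

lemma ccdf_integral_le: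
  assumes "1 \<le> k" "1 \<le> m"
  shows "(LBINT y:{0..}. erlang_ccdf k y * erlang_ccdf m y) \<le> real m"
proof -
  have "ennreal (LBINT y:{0..}. erlang_ccdf k y * erlang_ccdf m y) \<le>
      (\<integral>\<^sup>+y\<in>{0..}. ennreal (erlang_ccdf m y) \<partial>lborel)"
    unfolding ennreal_ccdf_integral[OF assms]
    by (intro nn_integral_mono mult_right_mono ennreal_leI mult_left_le_one_le) auto
  also have "\<dots> = ennreal (real m)"
    by (simp add: nn_integral_erlang_ccdf[OF assms(2)] ennreal_of_nat_eq_real_of_nat)
  finally show ?thesis by simp
qed

text \<open>Terms with \<open>d > m\<close> vanish; what remains is the mean of the binomial law,
  known for Bernstein polynomials.\<close>

lemma suminf_degree_Bi:
  assumes "0 \<le> \<eta>" "\<eta> \<le> 1"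
  shows "(\<Sum>d. ennreal (real d) * ennreal (Bi d m \<eta>)) = ennreal (real m * \<eta>)"
proof -
  have "(\<Sum>d. ennreal (real d) * ennreal (Bi d m \<eta>)) = (\<Sum>d\<le>m. ennreal (real d) * ennreal (Bi d m \<eta>))"
    by (intro suminf_finite) (auto simp: Bi_def binomial_eq_0)
  also have "\<dots> = ennreal (\<Sum>d\<le>m. real d * Bi d m \<eta>)"
    using assms by (simp add: ennreal_mult[symmetric] Bi_nonneg sum_ennreal)
  finally show ?thesis
    by (simp add: Bi_eq_Bernstein)
qed

context erlang_weighted_tree
begin

lemma emeasure_root_degree:
  assumes P: "set_pmf P \<subseteq> {1..}"
  shows "emeasure M {\<omega> \<in> space M. num_children (n \<omega>) (v \<omega>) (\<zeta> \<omega>) [] = d} =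
    (\<integral>\<^sup>+\<omega>. ennreal (Bi d (n \<omega> []) (keep_prob P (v \<omega> []))) \<partial>M)"
proof -
  have in_S: "(\<lambda>a\<in>{}. mark_at a \<omega>, v \<omega> []) \<in> space (Pi\<^sub>M {} (\<lambda>_. mark_space) \<Otimes>\<^sub>M borel)" for \<omega>
    by (simp add: space_pair_measure space_PiM fun_eq_iff)
  show ?thesis
    using emeasure_num_children[OF P Nil_in_words, of "{}"
        "space (Pi\<^sub>M {} (\<lambda>_. mark_space) \<Otimes>\<^sub>M borel)" UNIV d] in_S
      sets.top[of "count_space UNIV \<Otimes>\<^sub>M borel :: (nat \<times> real) measure"]
    by (simp add: space_pair_measure)
qed

lemma root_degree_prob:
  assumes P: "set_pmf P \<subseteq> {1..}"
  shows "measure M {\<omega> \<in> space M. num_children (n \<omega>) (v \<omega>) (\<zeta> \<omega>) [] = d} =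
    (\<Sum>\<^sub>\<infinity>m\<in>{1..}. pmf P m *
      (LBINT x:{0..}. exp (- x) * x ^ m / fact m * Bi d m (keep_prob P x)))"
proof -
  note [measurable] = keep_prob_measurable[OF P]
  define a where "a m = (LBINT x:{0..}. exp (- x) * x ^ m / fact m * Bi d m (keep_prob P x))" for m
  have Bi01: "0 \<le> Bi d m (keep_prob P x)" "Bi d m (keep_prob P x) \<le> 1" for m x
    using P keep_prob_le_1[OF P] by (auto intro: Bi_nonneg Bi_le_1)
  have a0: "0 \<le> a m" for m
    unfolding a_def set_lebesgue_integral_def using Bi01
    by (intro Bochner_Integration.integral_nonneg) (auto split: split_indicator)
  \<comment> \<open>A binomial weight is at most 1, so \<open>a m\<close> is bounded by the total
    mass of the Erlang density; this makes \<open>a\<close> integrable under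
    \<open>P\<close>.\<close>
  have "ennreal (a m) \<le> (\<integral>\<^sup>+x. ennreal (erlang_density m 1 x) \<partial>lborel)" for m
    unfolding a_def ennreal_erlang_Bi_integral[OF P] using Bi01
    by (intro nn_integral_mono) (simp add: ennreal_mult[symmetric] mult_left_le)
  then have a1: "a m \<le> 1" for m
    by (simp add: ennreal_le_1)
  have "emeasure M {\<omega> \<in> space M. num_children (n \<omega>) (v \<omega>) (\<zeta> \<omega>) [] = d} =
      (\<integral>\<^sup>+m. (\<integral>\<^sup>+x. ennreal (erlang_density m 1 x) * ennreal (Bi d m (keep_prob P x)) \<partial>lborel) \<partial>measure_pmf P)"
    unfolding emeasure_root_degree[OF P]
    by (rule nn_integral_root_type[where f = "\<lambda>m x. ennreal (Bi d m (keep_prob P x))"]) measurable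
  also have "\<dots> = (\<integral>\<^sup>+m. ennreal (a m) \<partial>measure_pmf P)"
    by (simp only: a_def ennreal_erlang_Bi_integral[OF P])
  also have "\<dots> = ennreal (\<integral>m. a m \<partial>measure_pmf P)"
    using a0 a1 by (intro nn_integral_eq_integral measure_pmf.integrable_const_bound[where B = 1]) auto
  finally have "measure M {\<omega> \<in> space M. num_children (n \<omega>) (v \<omega>) (\<zeta> \<omega>) [] = d} =
      (\<integral>m. a m \<partial>measure_pmf P)"
    using a0 by (simp add: measure_def)
  then show ?thesis
    unfolding infsum_pmf_eq_integral[OF P] a_def .
qed

lemma root_degree_mean:
  assumes P: "set_pmf P \<subseteq> {1..}" and mean: "integrable (measure_pmf P) real"
  defines "I \<equiv> \<lambda>k m. LBINT y:{0..}. erlang_ccdf k y * erlang_ccdf m y"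
  shows "integrable M (\<lambda>\<omega>. real (num_children (n \<omega>) (v \<omega>) (\<zeta> \<omega>) []))"
    and "(LINT \<omega>|M. real (num_children (n \<omega>) (v \<omega>) (\<zeta> \<omega>) [])) =
      (\<Sum>\<^sub>\<infinity>m\<in>{1..}. \<Sum>\<^sub>\<infinity>k\<in>{1..}. pmf P m * pmf P k * I k m)"
proof -
  note [measurable] = keep_prob_measurable[OF P]
  let ?D = "\<lambda>\<omega>. num_children (n \<omega>) (v \<omega>) (\<zeta> \<omega>) []"
  let ?q = "\<lambda>\<omega>. keep_prob P (v \<omega> [])"
  have D: "?D \<in> measurable M (count_space UNIV)"
    by (rule num_children_measurable) simp
  have D': "(\<lambda>\<omega>. real (?D \<omega>)) \<in> borel_measurable M"
    by (rule measurable_compose[OF D]) simp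
  have q01: "0 \<le> keep_prob P x" "keep_prob P x \<le> 1" for x
    using P keep_prob_le_1[OF P] by auto
  have P_ge_1: "1 \<le> k" if "k \<in> set_pmf P" for k
    using P that by auto
  \<comment> \<open>For \<open>m\<close> in the support of \<open>P\<close>, \<open>b m\<close>
    turns out to be the mean number of children of the root given that its potential degree is
    \<open>m\<close>.\<close>
  define b where "b m = (\<integral>k. I k m \<partial>measure_pmf P)" for m
  have I_nonneg: "0 \<le> I k m" for k m
    unfolding I_def by (rule ccdf_integral_nonneg)
  have I_le: "I k m \<le> real m" if "1 \<le> k" "1 \<le> m" for k m
    using that unfolding I_def by (rule ccdf_integral_le)
  have I_integrable: "integrable (measure_pmf P) (\<lambda>k. I k m)" if "1 \<le> m" for m
    using I_nonneg I_le[OF P_ge_1 that]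
    by (intro measure_pmf.integrable_const_bound[where B = "real m"]) (auto simp: AE_measure_pmf_iff)
  have b_nonneg: "0 \<le> b m" for m
    unfolding b_def using I_nonneg by (intro Bochner_Integration.integral_nonneg) auto
  have b_le: "b m \<le> real m" if "1 \<le> m" for m
  proof -
    have "b m \<le> (\<integral>k. real m \<partial>measure_pmf P)"
      unfolding b_def using I_le[OF P_ge_1 that]
      by (intro integral_mono_AE I_integrable that) (auto simp: AE_measure_pmf_iff)
    then show ?thesis by simp
  qed
  \<comment> \<open>The finite mean of \<open>P\<close> enters here, through
    \<open>b m \<le> m\<close>.\<close>
  have b_integrable: "integrable (measure_pmf P) b"
    using mean b_nonneg b_le[OF P_ge_1]
    by (intro Bochner_Integration.integrable_bound[OF mean]) (auto simp: AE_measure_pmf_iff)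
  \<comment> \<open>Splitting by the value \<open>d\<close> reduces the mean to the probabilities in
    \<open>emeasure_root_degree\<close>; the sum over \<open>d\<close> is then carried out for each
    type, where it is a binomial mean, before the type is integrated out.\<close>
  have "(\<integral>\<^sup>+\<omega>. ennreal (real (?D \<omega>)) \<partial>M) =
      (\<Sum>d. \<integral>\<^sup>+\<omega>. ennreal (real (?D \<omega>)) * indicator {\<omega>. ?D \<omega> = d} \<omega> \<partial>M)"
    using D D' by (intro nn_integral_split_countable) auto
  also have "\<dots> = (\<Sum>d. \<integral>\<^sup>+\<omega>. ennreal (real d) * ennreal (Bi d (n \<omega> []) (?q \<omega>)) \<partial>M)"
  proof (intro suminf_cong)
    fix d
    have D_sets: "{\<omega> \<in> space M. ?D \<omega> = d} \<in> sets M"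
      using measurable_sets[OF D, of "{d}"] by (simp add: vimage_def Int_def conj_commute)
    have "(\<integral>\<^sup>+\<omega>. ennreal (real (?D \<omega>)) * indicator {\<omega>. ?D \<omega> = d} \<omega> \<partial>M) =
        (\<integral>\<^sup>+\<omega>. ennreal (real d) * indicator {\<omega> \<in> space M. ?D \<omega> = d} \<omega> \<partial>M)"
      by (intro nn_integral_cong) (auto split: split_indicator)
    also have "\<dots> = ennreal (real d) * (\<integral>\<^sup>+\<omega>. ennreal (Bi d (n \<omega> []) (?q \<omega>)) \<partial>M)"
      using D_sets by (simp add: nn_integral_cmult_indicator emeasure_root_degree[OF P])
    also have "\<dots> = (\<integral>\<^sup>+\<omega>. ennreal (real d) * ennreal (Bi d (n \<omega> []) (?q \<omega>)) \<partial>M)"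
      using measurable_compose[OF type_measurable[OF Nil_in_words] Bi_type_measurable[OF P]]
      by (intro nn_integral_cmult[symmetric]) simp
    finally show "(\<integral>\<^sup>+\<omega>. ennreal (real (?D \<omega>)) * indicator {\<omega>. ?D \<omega> = d} \<omega> \<partial>M) =
        (\<integral>\<^sup>+\<omega>. ennreal (real d) * ennreal (Bi d (n \<omega> []) (?q \<omega>)) \<partial>M)" .
  qed
  also have "\<dots> = (\<integral>\<^sup>+\<omega>. (\<Sum>d. ennreal (real d) * ennreal (Bi d (n \<omega> []) (?q \<omega>))) \<partial>M)"
    using measurable_compose[OF type_measurable[OF Nil_in_words] Bi_type_measurable[OF P]]
    by (intro nn_integral_suminf[symmetric]) simp
  also have "\<dots> = (\<integral>\<^sup>+\<omega>. ennreal (real (n \<omega> []) * ?q \<omega>) \<partial>M)"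
    by (simp add: suminf_degree_Bi q01)
  also have "\<dots> = (\<integral>\<^sup>+m. (\<integral>\<^sup>+x. ennreal (erlang_density m 1 x) * ennreal (real m * keep_prob P x) \<partial>lborel) \<partial>measure_pmf P)"
    by (rule nn_integral_root_type[where f = "\<lambda>m x. ennreal (real m * keep_prob P x)"]) measurable
  also have "\<dots> = (\<integral>\<^sup>+m. ennreal (b m) \<partial>measure_pmf P)"
  proof (intro nn_integral_cong_AE AE_pmfI)
    fix m assume "m \<in> set_pmf P"
    note m = P_ge_1[OF this]
    have "(\<integral>\<^sup>+x. ennreal (erlang_density m 1 x) * ennreal (real m * keep_prob P x) \<partial>lborel) =
        (\<integral>\<^sup>+k. (\<integral>\<^sup>+y\<in>{0..}. ennreal (erlang_ccdf k y * erlang_ccdf m y) \<partial>lborel) \<partial>measure_pmf P)"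
      by (simp only: nn_integral_degree_keep_prob[OF P m] nn_integral_survival_ccdf)
    also have "\<dots> = (\<integral>\<^sup>+k. ennreal (I k m) \<partial>measure_pmf P)"
      by (intro nn_integral_cong_AE AE_pmfI) (simp only: I_def ennreal_ccdf_integral[OF P_ge_1 m])
    also have "\<dots> = ennreal (b m)"
      unfolding b_def using I_nonneg by (intro nn_integral_eq_integral I_integrable m) auto
    finally show "(\<integral>\<^sup>+x. ennreal (erlang_density m 1 x) * ennreal (real m * keep_prob P x) \<partial>lborel) =
        ennreal (b m)" .
  qed
  also have "\<dots> = ennreal (\<integral>m. b m \<partial>measure_pmf P)"
    using b_nonneg by (intro nn_integral_eq_integral b_integrable) auto
  finally have nn: "(\<integral>\<^sup>+\<omega>. ennreal (real (?D \<omega>)) \<partial>M) = ennreal (\<integral>m. b m \<partial>measure_pmf P)" .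
  show int: "integrable M (\<lambda>\<omega>. real (?D \<omega>))"
    using D' nn by (intro integrableI_nonneg) auto
  have "(LINT \<omega>|M. real (?D \<omega>)) = (\<integral>m. b m \<partial>measure_pmf P)"
    using nn D' b_nonneg by (subst integral_eq_nn_integral) (auto simp: integral_nonneg)
  also have "\<dots> = (\<Sum>\<^sub>\<infinity>m\<in>{1..}. pmf P m * (\<Sum>\<^sub>\<infinity>k\<in>{1..}. pmf P k * I k m))"
    unfolding b_def by (simp only: infsum_pmf_eq_integral[OF P])
  also have "\<dots> = (\<Sum>\<^sub>\<infinity>m\<in>{1..}. \<Sum>\<^sub>\<infinity>k\<in>{1..}. pmf P m * pmf P k * I k m)"
    by (simp add: infsum_cmult_right' mult.assoc)
  finally show "(LINT \<omega>|M. real (?D \<omega>)) =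
      (\<Sum>\<^sub>\<infinity>m\<in>{1..}. \<Sum>\<^sub>\<infinity>k\<in>{1..}. pmf P m * pmf P k * I k m)" .
qed

end

theorem theorem5p1:
  fixes P :: "nat pmf"
    and M :: "'w measure"
    and n :: "'w \<Rightarrow> nat list \<Rightarrow> nat"
    and v \<zeta> :: "'w \<Rightarrow> nat list \<Rightarrow> real"
  assumes "set_pmf P \<subseteq> {1..}"
    and "integrable (measure_pmf P) real"
    and "pmf P 1 < 1"
    and "erlang_weighted_tree M P n v \<zeta>"
  shows
    "(\<forall>i\<in>words. \<forall>d.
        has_cond_prob_given_type M n v i
          {\<omega> \<in> space M. num_children (n \<omega>) (v \<omega>) (\<zeta> \<omega>) i = d}
          (\<lambda>m x. Bi d m (keep_prob P x)) \<and>
        has_cond_prob_given_type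
          (uniform_measure M {\<omega> \<in> space M. i \<in> ewt (n \<omega>) (v \<omega>) (\<zeta> \<omega>)}) n v i
          {\<omega> \<in> space M. num_children (n \<omega>) (v \<omega>) (\<zeta> \<omega>) i = d}
          (\<lambda>m x. Bi d m (keep_prob P x))) \<and>
     (\<forall>d. measure M {\<omega> \<in> space M. num_children (n \<omega>) (v \<omega>) (\<zeta> \<omega>) [] = d} =
        (\<Sum>\<^sub>\<infinity>m\<in>{1..}. pmf P m *
           (LBINT x:{0..}. exp (- x) * x ^ m / fact m * Bi d m (keep_prob P x)))) \<and>
     integrable M (\<lambda>\<omega>. real (num_children (n \<omega>) (v \<omega>) (\<zeta> \<omega>) [])) \<and>
     (LINT \<omega>|M. real (num_children (n \<omega>) (v \<omega>) (\<zeta> \<omega>) [])) =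
        (\<Sum>\<^sub>\<infinity>m\<in>{1..}. \<Sum>\<^sub>\<infinity>k\<in>{1..}. pmf P m * pmf P k *
           (LBINT y:{0..}. erlang_ccdf k y * erlang_ccdf m y)) \<and>
     (\<Sum>\<^sub>\<infinity>m\<in>{1..}. \<Sum>\<^sub>\<infinity>k\<in>{1..}. pmf P m * pmf P k *
           (LBINT y:{0..}. erlang_ccdf k y * erlang_ccdf m y)) =
        (\<Sum>\<^sub>\<infinity>m\<in>{1..}. \<Sum>\<^sub>\<infinity>k\<in>{1..}. pmf P m * pmf P k *
           (\<Sum>a=0..k-1. \<Sum>l=0..m-1. real ((a + l) choose a) * (1 / 2) ^ (a + l + 1)))"
proof -
  interpret erlang_weighted_tree M P n v \<zeta>
    by fact
  note P = assms(1)
  \<comment> \<open>The two double series agree term by term, so their equality raises no question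
    of convergence.\<close>
  have "(\<Sum>\<^sub>\<infinity>m\<in>{1..}. \<Sum>\<^sub>\<infinity>k\<in>{1..}. pmf P m * pmf P k *
        (LBINT y:{0..}. erlang_ccdf k y * erlang_ccdf m y)) =
      (\<Sum>\<^sub>\<infinity>m\<in>{1..}. \<Sum>\<^sub>\<infinity>k\<in>{1..}. pmf P m * pmf P k *
        (\<Sum>a=0..k-1. \<Sum>l=0..m-1. real ((a + l) choose a) * (1 / 2) ^ (a + l + 1)))"
    by (intro infsum_cong arg_cong2[where f = "(*)"] refl ccdf_integral_eq_sum) auto
  then show ?thesis
    using cond_prob_num_children_uncond[OF P] cond_prob_num_children_ewt[OF P]
      root_degree_prob[OF P] root_degree_mean[OF P assms(2)]
    by (intro conjI allI ballI)
qed

end
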